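(* Let $\boldsymbol{\alpha}$ be a multi-index and let $\boldsymbol{\alpha}^{*}=(\alpha_1^{*},\ldots,\alpha_t^{*})$. Then $$F_{\boldsymbol{\alpha}}(z) = G_{\boldsymbol{\alpha}^{\backprime}}(z)$$ for every $z\in\mathbb{C}$ with $\operatorname{Re} z > -\alpha_1^{*}$.
   Context: $\mathbb{N}$ denotes the set of non-negative integers. A multi-index is a finite (nonempty) sequence $\boldsymbol{\alpha}=(\alpha_1,\ldots,\alpha_s)$ of positive integers; its weight is $|\boldsymbol{\alpha}|=\alpha_1+\cdots+\alpha_s$. Multi-indices of weight $m\ge 1$ correspond bijectively to subsets of $\{1,\ldots,m-1\}$ via $\mathcal{S}_m(\alpha_1,\ldots,\alpha_s)=\{\alpha_1,\alpha_1+\alpha_2,\ldots,\alpha_1+\cdots+\alpha_{s-1}\}$. For $\boldsymbol{\alpha}$ of weight $m$, $\boldsymbol{\alpha}^{*}=\mathcal{S}_m^{-1}(\{1,\ldots,m-1\}\setminus \mathcal{S}_m(\boldsymbol{\alpha}))$. The reversal is $\boldsymbol{\alpha}^{\tau}=(\alpha_s,\ldots,\alpha_1)$, and $\boldsymbol{\alpha}^{\backprime}=(\boldsymbol{\alpha}^{*})^{\tau}=(\boldsymbol{\alpha}^{\tau})^{*}$. For a sequence $a\in\mathbb{C}^{\mathbb{N}}$, $(\Delta a)(n)=a(n)-a(n+1)$, $\Delta^n$ is the $n$-fold composition of $\Delta$ ($\Delta^0=\mathrm{id}$), and $(\nabla a)(n)=(\Delta^n a)(0)$. For a multi-index $\boldsymbol{\alpha}=(\alpha_1,\ldots,\alpha_s)$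 and $n\in\mathbb{N}$, $$S_{\boldsymbol{\alpha}}(n)=\sum_{n>n_1\ge\cdots\ge n_s\ge 0}\frac{1}{(n_1+1)^{\alpha_1}\cdots(n_s+1)^{\alpha_s}},$$ so $S_{\boldsymbol{\alpha}}(0)=0$. The Newton series interpolating $S_{\boldsymbol{\alpha}}$ is $$F_{\boldsymbol{\alpha}}(z)=\sum_{n=0}^{\infty}(-1)^n(\nabla S_{\boldsymbol{\alpha}})(n)\binom{z}{n},\qquad \binom{z}{n}=\frac{z(z-1)\cdots(z-n+1)}{n!}.$$ For a multi-index $\boldsymbol{\alpha}=(\alpha_1,\ldots,\alpha_s)$, $G_{\boldsymbol{\alpha}}(z)$ is defined by $$G_{\boldsymbol{\alpha}}(z)=\sum\left(\frac{1}{m_{1,1}}-\frac{1}{m_{1,1}+z}\right)\prod_{j=2}^{\alpha_1}\frac{1}{m_{1,j}}\;\prod_{i=2}^{s}\left(\frac{1}{m_{i,1}+z}\prod_{j=2}^{\alpha_i}\frac{1}{m_{i,j}}\right),$$ where the sum is over all families of positive integers $(m_{i,j})_{1\le i\le s,\,1\le j\le\alpha_i}$ with $m_{i,1}>m_{i,2}>\cdots>m_{i,\alpha_i}$ for each $i$ and $m_{i,\alpha_i}\ge m_{i+1,1}$ for $1\le i\le s-1$. The constraints force $m_{i,1}\ge\alpha_s$ for all $i$, so the terms are finite for $z\in\mathbb{C}\setminus\{-\alpha_s,-\alpha_s-1,\ldots\}$, and $G_{\boldsymbol{\alpha}}$ is regarded as a function there (it is meromorphic on $\mathbb{C}$ with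 poles at most at $-\alpha_s,-\alpha_s-1,\ldots$). Note that the last entry of $\boldsymbol{\alpha}^{\backprime}$ is $\alpha_1^{*}$. *)

theory Defs
  imports "HOL-Analysis.Analysis"
begin

subsection \<open>Multi-indices\<close>

definition multi_index :: "nat list \<Rightarrow> bool" where
  "multi_index \<alpha> \<longleftrightarrow> \<alpha> \<noteq> [] \<and> (\<forall>a\<in>set \<alpha>. a > 0)"

abbreviation weight :: "nat list \<Rightarrow> nat" where
  "weight \<alpha> \<equiv> sum_list \<alpha>"

definition multi_indices :: "nat \<Rightarrow> nat list set" where
  "multi_indices m = {\<alpha>. multi_index \<alpha> \<and> weight \<alpha> = m}"

text \<open>The map \<open>\<S>\<^sub>m\<close>. Its value does not mention \<open>m\<close>, which only determines the domain
  \<open>multi_indices m\<close> and the codomain, the subsets of \<open>{1..<m}\<close>.\<close>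

definition partial_sums :: "nat list \<Rightarrow> nat set" where
  "partial_sums \<alpha> = {sum_list (take k \<alpha>) | k. 1 \<le> k \<and> k < length \<alpha>}"

definition dual :: "nat list \<Rightarrow> nat list" where
  "dual \<alpha> = the_inv_into (multi_indices (weight \<alpha>)) partial_sums
              ({1..<weight \<alpha>} - partial_sums \<alpha>)"

definition backprime :: "nat list \<Rightarrow> nat list" where
  "backprime \<alpha> = rev (dual \<alpha>)"

text \<open>\<open>dual\<close> is well defined: \<open>partial_sums\<close> is a bijection for every weight \<open>m \<ge> 1\<close>.\<close>

lemma partial_sums_singleton: "partial_sums [x] = {}"
  by (auto simp: partial_sums_def)

lemma partial_sums_snoc:
  assumes "\<beta> \<noteq> []"
  shows "partial_sums (\<beta> @ [x]) = insert (weight \<beta>) (partial_sums \<beta>)"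
proof -
  have "{k. 1 \<le> k \<and> k < length (\<beta> @ [x])} = insert (length \<beta>) {k. 1 \<le> k \<and> k < length \<beta>}"
    using assms by (auto simp: Suc_le_eq)
  moreover have "partial_sums \<gamma> = (\<lambda>k. sum_list (take k \<gamma>)) ` {k. 1 \<le> k \<and> k < length \<gamma>}" for \<gamma>
    by (auto simp: partial_sums_def)
  ultimately show ?thesis
    by (auto simp: image_iff)
qed

lemma multi_index_snoc:
  "multi_index (\<beta> @ [x]) \<longleftrightarrow> x > 0 \<and> (\<beta> = [] \<or> multi_index \<beta>)"
  by (auto simp: multi_index_def)

lemma partial_sums_subset:
  "multi_index \<alpha> \<Longrightarrow> partial_sums \<alpha> \<subseteq> {1..<weight \<alpha>}"
proof (induction \<alpha> rule: rev_induct)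
  case (snoc x \<beta>)
  show ?case
  proof (cases "\<beta> = []")
    case False
    then have "multi_index \<beta>" "x > 0" using snoc.prems by (auto simp: multi_index_snoc)
    moreover from this have "weight \<beta> \<ge> 1"
      using False by (cases \<beta>) (auto simp: multi_index_def)
    ultimately show ?thesis
      using snoc.IH False by (force simp: partial_sums_snoc)
  qed (simp add: partial_sums_singleton)
qed (simp add: multi_index_def)

lemma partial_sums_inj:
  "multi_index \<alpha> \<Longrightarrow> multi_index \<beta> \<Longrightarrow> weight \<alpha> = weight \<beta> \<Longrightarrow>
    partial_sums \<alpha> = partial_sums \<beta> \<Longrightarrow> \<alpha> = \<beta>"
proof (induction \<alpha> arbitrary: \<beta> rule: rev_induct)
  case (snoc x \<alpha>)
  from snoc.prems obtain \<gamma> y where \<beta>: "\<beta> = \<gamma> @ [y]"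
    by (cases \<beta> rule: rev_cases) (auto simp: multi_index_def)
  show ?case
  proof (cases "\<alpha> = [] \<or> \<gamma> = []")
    case True
    then show ?thesis
      using snoc.prems
      by (cases "\<alpha> = []"; cases "\<gamma> = []") (auto simp: \<beta> partial_sums_singleton partial_sums_snoc)
  next
    case False
    then have mi: "multi_index \<alpha>" "multi_index \<gamma>"
      using snoc.prems by (auto simp: \<beta> multi_index_snoc)
    have eq: "insert (weight \<alpha>) (partial_sums \<alpha>) = insert (weight \<gamma>) (partial_sums \<gamma>)"
      using snoc.prems(4) False by (simp add: \<beta> partial_sums_snoc)
    have less: "\<forall>a\<in>partial_sums \<alpha>. a < weight \<alpha>" "\<forall>a\<in>partial_sums \<gamma>. a < weight \<gamma>"
      using partial_sums_subset mi by fastforce+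
    have w: "weight \<alpha> = weight \<gamma>"
      using eq less by (metis insertE insertI1 less_asym)
    have "partial_sums \<alpha> = partial_sums \<gamma>"
      using eq less w by (metis insert_ident less_irrefl)
    then have "\<alpha> = \<gamma>" using snoc.IH mi w by blast
    then show ?thesis using snoc.prems(3) by (simp add: \<beta>)
  qed
qed (simp add: multi_index_def)

lemma partial_sums_surj:
  "m \<ge> 1 \<Longrightarrow> A \<subseteq> {1..<m} \<Longrightarrow> \<exists>\<alpha>\<in>multi_indices m. partial_sums \<alpha> = A"
proof (induction m arbitrary: A rule: less_induct)
  case (less m)
  show ?case
  proof (cases "A = {}")
    case True
    then show ?thesis using less.prems
      by (intro bexI[of _ "[m]"]) (auto simp: multi_indices_def multi_index_def partial_sums_singleton)
  next
    case False
    have fin: "finite A" using less.prems(2) finite_subset by blast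
    have k: "Max A \<in> A" using False fin by simp
    then have k': "1 \<le> Max A" "Max A < m" using less.prems(2) by fastforce+
    have "A - {Max A} \<subseteq> {1..<Max A}"
    proof
      fix x assume x: "x \<in> A - {Max A}"
      then have "x \<le> Max A" "x \<noteq> Max A" using fin by auto
      moreover have "1 \<le> x" using x less.prems(2) by auto
      ultimately show "x \<in> {1..<Max A}" by simp
    qed
    from less.IH[OF k'(2,1) this] obtain \<beta> where
      \<beta>: "multi_index \<beta>" "weight \<beta> = Max A" "partial_sums \<beta> = A - {Max A}"
      by (auto simp: multi_indices_def)
    have "\<beta> \<noteq> []" using \<beta>(1) by (simp add: multi_index_def)
    then have "partial_sums (\<beta> @ [m - Max A]) = A"
      using \<beta> k by (auto simp: partial_sums_snoc)
    moreover have "\<beta> @ [m - Max A] \<in> multi_indices m"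
      using \<beta> k' by (simp add: multi_indices_def multi_index_snoc)
    ultimately show ?thesis by blast
  qed
qed

lemma bij_betw_partial_sums:
  assumes "m \<ge> 1"
  shows "bij_betw partial_sums (multi_indices m) (Pow {1..<m})"
  unfolding bij_betw_def
proof
  show "inj_on partial_sums (multi_indices m)"
    by (rule inj_onI) (auto simp: multi_indices_def intro: partial_sums_inj)
  show "partial_sums ` multi_indices m = Pow {1..<m}"
  proof
    show "partial_sums ` multi_indices m \<subseteq> Pow {1..<m}"
      using partial_sums_subset by (auto simp: multi_indices_def)
    show "Pow {1..<m} \<subseteq> partial_sums ` multi_indices m"
    proof
      fix A assume "A \<in> Pow {1..<m}"
      then obtain \<alpha> where "\<alpha> \<in> multi_indices m" "partial_sums \<alpha> = A"
        using partial_sums_surj assms by blast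
      then show "A \<in> partial_sums ` multi_indices m" by blast
    qed
  qed
qed

lemma dual_props:
  assumes "multi_index \<alpha>"
  shows "multi_index (dual \<alpha>)" "weight (dual \<alpha>) = weight \<alpha>"
    "partial_sums (dual \<alpha>) = {1..<weight \<alpha>} - partial_sums \<alpha>"
proof -
  have m: "weight \<alpha> \<ge> 1" using assms by (cases \<alpha>) (auto simp: multi_index_def)
  note b = bij_betw_partial_sums[OF m]
  have "dual \<alpha> \<in> multi_indices (weight \<alpha>)"
    unfolding dual_def
    by (rule the_inv_into_into[OF bij_betw_imp_inj_on[OF b]])
       (use bij_betw_imp_surj_on[OF b] in auto)
  then show "multi_index (dual \<alpha>)" "weight (dual \<alpha>) = weight \<alpha>"
    by (auto simp: multi_indices_def)
  show "partial_sums (dual \<alpha>) = {1..<weight \<alpha>} - partial_sums \<alpha>"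
    unfolding dual_def
    by (rule f_the_inv_into_f_bij_betw[OF b]) auto
qed


subsection \<open>Differences and Newton series\<close>

definition Delta :: "(nat \<Rightarrow> complex) \<Rightarrow> nat \<Rightarrow> complex" where
  "Delta a = (\<lambda>n. a n - a (n + 1))"

definition nabla :: "(nat \<Rightarrow> complex) \<Rightarrow> nat \<Rightarrow> complex" where
  "nabla a n = (Delta ^^ n) a 0"

definition S_indices :: "nat list \<Rightarrow> nat \<Rightarrow> nat list set" where
  "S_indices \<alpha> n = {ns. length ns = length \<alpha> \<and> sorted_wrt (\<ge>) ns \<and> (\<forall>k\<in>set ns. k < n)}"

definition S :: "nat list \<Rightarrow> nat \<Rightarrow> complex" where
  "S \<alpha> n = (\<Sum>ns\<in>S_indices \<alpha> n. \<Prod>i<length \<alpha>. 1 / (of_nat (ns ! i) + 1) ^ (\<alpha> ! i))"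

lemma finite_S_indices: "finite (S_indices \<alpha> n)"
proof (rule finite_subset)
  show "S_indices \<alpha> n \<subseteq> {ns. set ns \<subseteq> {..<n} \<and> length ns = length \<alpha>}"
    by (auto simp: S_indices_def)
qed (simp add: finite_lists_length_eq)

definition F_term :: "nat list \<Rightarrow> complex \<Rightarrow> nat \<Rightarrow> complex" where
  "F_term \<alpha> z n = (-1) ^ n * nabla (S \<alpha>) n * (z gchoose n)"

definition F :: "nat list \<Rightarrow> complex \<Rightarrow> complex" where
  "F \<alpha> z = (\<Sum>n. F_term \<alpha> z n)"


subsection \<open>The functions \<open>G\<close>\<close>

text \<open>A family \<open>(m\<^sub>i\<^sub>,\<^sub>j)\<close> is a list of rows, so \<open>ms ! i ! j\<close> (indices starting from 0) stands for
  \<open>m\<close> with subscripts \<open>i + 1\<close> and \<open>j + 1\<close>.\<close>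

definition G_indices :: "nat list \<Rightarrow> nat list list set" where
  "G_indices \<alpha> = {ms. length ms = length \<alpha> \<and>
     (\<forall>i<length \<alpha>. length (ms ! i) = \<alpha> ! i \<and> sorted_wrt (>) (ms ! i) \<and> (\<forall>k\<in>set (ms ! i). k > 0)) \<and>
     (\<forall>i. Suc i < length \<alpha> \<longrightarrow> last (ms ! i) \<ge> hd (ms ! Suc i))}"

definition G_term :: "nat list \<Rightarrow> complex \<Rightarrow> nat list list \<Rightarrow> complex" where
  "G_term \<alpha> z ms =
     (1 / of_nat (ms ! 0 ! 0) - 1 / (of_nat (ms ! 0 ! 0) + z)) *
     (\<Prod>j = 1..<\<alpha> ! 0. 1 / of_nat (ms ! 0 ! j)) *
     (\<Prod>i = 1..<length \<alpha>. 1 / (of_nat (ms ! i ! 0) + z) * (\<Prod>j = 1..<\<alpha> ! i. 1 / of_nat (ms ! i ! j)))"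

text \<open>This is meaningful only when no \<open>m\<^sub>i\<^sub>,\<^sub>1 + z\<close> vanishes, that is, for \<open>z\<close> not among
  \<open>- \<alpha>\<^sub>s, - \<alpha>\<^sub>s - 1, \<dots>\<close>.\<close>

definition G :: "nat list \<Rightarrow> complex \<Rightarrow> complex" where
  "G \<alpha> z = (\<Sum>\<^sub>\<infinity>ms\<in>G_indices \<alpha>. G_term \<alpha> z ms)"

end

theory Submission
  imports Defs
begin

text \<open>
  The proof transports one nested sum into the other through a two-parameter connector. Put
  \<open>\<beta> = \<alpha>\<^sup>*\<close> and let \<open>lead_sum \<beta> n\<close> be the part of the sum \<open>S\<^sub>\<beta>\<close> whose outermost index is \<open>n\<close>. The
  operator \<open>\<nabla>\<close> turns division by \<open>n + 1\<close> into averaging over \<open>0, \<dots>, n\<close> and back; since duality of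
  multi-indices exchanges the same two operations on the first entry, \<open>\<nabla>\<close> sends
  \<open>lead_sum \<alpha>\<close> to \<open>lead_sum \<beta>\<close> (\<open>nabla_lead_sum\<close>). The Newton series is therefore
  \<open>z\<close> times \<open>\<Sum>n. c\<^sub>n lead_sum \<beta> n\<close> with \<open>c\<^sub>n = (-1)\<^sup>n (z - 1 gchoose n) / (n + 1)\<close>.

  Replace \<open>c\<^sub>n\<close> by \<open>conn z n m = m! (1 - z)\<^sub>n / (m + n + 1)!\<close>, where \<open>(1 - z)\<^sub>n\<close> is the rising factorial,
  so that \<open>m = 0\<close> gives back \<open>c\<^sub>n\<close>, and call the resulting series \<open>conn_sum z \<beta> m\<close>. The connector has
  two difference equations, one for \<open>m\<close> and one that relates \<open>m\<close> to \<open>n\<close> (\<open>conn_diff_right\<close>,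
  \<open>conn_diff_left\<close>). They express \<open>conn_sum z \<beta> m - conn_sum z \<beta> (m + 1)\<close> through a multi-index of
  smaller weight: lowering a first entry greater than 1 costs a factor \<open>1 / (m + 1)\<close>, removing a first
  entry equal to 1 costs \<open>1 / (m + 1 + z)\<close>. As \<open>conn_sum z \<beta> m\<close> tends to 0 when \<open>m\<close> grows, telescoping
  gives a nested sum, which peels off the smallest entry of a family \<open>(m\<^sub>i\<^sub>,\<^sub>j)\<close> at each
  step: these are exactly the families over which \<open>G\<close> of the reversal of \<open>\<beta>\<close> sums, with exactly its
  factors (\<open>G_weight_has_sum\<close>).

  All this takes place in the half-planes \<open>Re z + m + \<beta>\<^sub>1 > 0\<close>. There the connector decays like
  \<open>n\<close> to the power \<open>- Re z - m - 1\<close> and \<open>lead_sum \<beta> n\<close> like \<open>n\<close> to the power \<open>- \<beta>\<^sub>1\<close>, up to an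
  arbitrarily small exponent. The iterated sum may be rearranged into
  one sum over families because the summand, divided by \<open>z\<close>, is dominated by its value at the real point
  \<open>Re z\<close>. At real points these quotients are nonnegative, and the transport relations themselves show
  that their nested sum converges.
\<close>

section \<open>The outermost summation index of a multiple harmonic sum\<close>

text \<open>Strictly below \<open>n\<close> for the first index, weakly below the previous index for the others: the
  shift by \<open>Suc\<close> reconciles the two kinds of bound.\<close>

lemma S_indices_Cons:
  "S_indices (a # \<beta>) n = (\<lambda>(k, ns). k # ns) ` (SIGMA k:{..<n}. S_indices \<beta> (Suc k))"
proof (intro equalityI subsetI)
  fix ns assume "ns \<in> S_indices (a # \<beta>) n"
  then show "ns \<in> (\<lambda>(k, ns). k # ns) ` (SIGMA k:{..<n}. S_indices \<beta> (Suc k))"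
    by (cases ns) (force simp: S_indices_def less_Suc_eq_le)+
qed (force simp: S_indices_def less_Suc_eq_le)

lemma S_Nil: "S [] n = 1"
proof -
  have "S_indices [] n = {[]}" by (auto simp: S_indices_def)
  then show ?thesis by (simp add: S_def)
qed

lemma S_Cons: "S (a # \<beta>) n = (\<Sum>k<n. S \<beta> (Suc k) / of_nat (Suc k) ^ a)"
proof -
  have inj: "inj_on (\<lambda>(k, ns). k # ns) (SIGMA k:{..<n}. S_indices \<beta> (Suc k))"
    by (auto simp: inj_on_def)
  have "S (a # \<beta>) n = (\<Sum>(k, ns)\<in>(SIGMA k:{..<n}. S_indices \<beta> (Suc k)).
          1 / (of_nat k + 1) ^ a * (\<Prod>i<length \<beta>. 1 / (of_nat (ns ! i) + 1) ^ (\<beta> ! i)))"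
    unfolding S_def S_indices_Cons sum.reindex[OF inj]
    by (simp add: case_prod_unfold prod.lessThan_Suc_shift del: prod.lessThan_Suc)
  also have "\<dots> = (\<Sum>k<n. S \<beta> (Suc k) / of_nat (Suc k) ^ a)"
    by (subst sum.Sigma[symmetric])
       (simp_all add: finite_S_indices S_def sum_distrib_left sum_divide_distrib add_ac)
  finally show ?thesis .
qed

text \<open>With all indices shifted up by 1, this is the sum over
  \<open>n + 1 = n\<^sub>1 \<ge> n\<^sub>2 \<ge> \<dots> \<ge> n\<^sub>s \<ge> 1\<close> of the product of the \<open>1 / n\<^sub>i\<close> to the powers \<open>\<beta>\<^sub>i\<close>.\<close>

definition lead_sum :: "nat list \<Rightarrow> nat \<Rightarrow> complex" where
  "lead_sum \<beta> n = S (tl \<beta>) (Suc n) / of_nat (Suc n) ^ hd \<beta>"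

lemma S_eq_sum_lead_sum: "\<beta> \<noteq> [] \<Longrightarrow> S \<beta> n = (\<Sum>k<n. lead_sum \<beta> k)"
  by (cases \<beta>) (simp_all add: S_Cons lead_sum_def)

lemma S_0: "\<beta> \<noteq> [] \<Longrightarrow> S \<beta> 0 = 0"
  by (simp add: S_eq_sum_lead_sum)

lemma S_Suc: "\<beta> \<noteq> [] \<Longrightarrow> S \<beta> (Suc n) = S \<beta> n + lead_sum \<beta> n"
  by (simp add: S_eq_sum_lead_sum)

text \<open>The next two facts build \<open>lead_sum\<close> up from the front of the multi-index: raising the first entry
  divides by \<open>n + 1\<close>, and a new first entry 1 takes averages.\<close>

lemma lead_sum_Suc: "lead_sum (Suc a # \<beta>) n = lead_sum (a # \<beta>) n / of_nat (Suc n)"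
  by (simp add: lead_sum_def del: of_nat_Suc)

lemma lead_sum_1: "lead_sum (1 # \<beta>) n = S \<beta> (Suc n) / of_nat (Suc n)"
  by (simp add: lead_sum_def del: of_nat_Suc)

section \<open>Iterated differences\<close>

lemma nabla_0: "nabla a 0 = a 0"
  by (simp add: nabla_def)

lemma nabla_Suc: "nabla a (Suc n) = nabla (Delta a) n"
  by (simp add: nabla_def funpow_swap1)

lemma nabla_linear:
  "nabla (\<lambda>k. c * a k + d * b k) n = c * nabla a n + d * nabla b n"
proof (induction n arbitrary: a b)
  case (Suc n)
  have "Delta (\<lambda>k. c * a k + d * b k) = (\<lambda>k. c * Delta a k + d * Delta b k)"
    by (auto simp: Delta_def algebra_simps)
  then show ?case by (simp add: nabla_Suc Suc.IH)
qed (simp add: nabla_0)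

lemma nabla_diff: "nabla (\<lambda>k. a k - b k) n = nabla a n - nabla b n"
  using nabla_linear[of 1 a "-1" b n] by simp

lemma nabla_add: "nabla (\<lambda>k. a k + b k) n = nabla a n + nabla b n"
  using nabla_linear[of 1 a 1 b n] by simp

lemma nabla_uminus: "nabla (\<lambda>k. - a k) n = - nabla a n"
  using nabla_linear[of "-1" a 0 a n] by simp

lemma nabla_shift: "nabla (\<lambda>k. a (Suc k)) n = nabla a n - nabla a (Suc n)"
  by (simp add: nabla_Suc Delta_def nabla_diff)

text \<open>Induction on the argument for all sequences at once: \<open>\<Delta>\<close> after \<open>\<nabla>\<close> is \<open>\<nabla>\<close> after the shift, and \<open>\<nabla>\<close>
  of \<open>\<Delta>\<close> is the shift of \<open>\<nabla>\<close>.\<close>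

lemma nabla_nabla: "nabla (nabla a) = a"
proof
  fix n show "nabla (nabla a) n = a n"
  proof (induction n arbitrary: a)
    case (Suc n)
    have "Delta (nabla a) = nabla (\<lambda>k. a (Suc k))"
      by (auto simp: Delta_def nabla_shift)
    then show ?case by (simp add: nabla_Suc Suc.IH)
  qed (simp add: nabla_0)
qed

text \<open>The discrete analogue of the Leibniz rule for multiplication by the variable; it is the equation
  from which \<open>nabla_div_index\<close> follows by solving for the quotient.\<close>

lemma nabla_times_index:
  "nabla (\<lambda>k. of_nat k * q k) (Suc n) = of_nat (Suc n) * (nabla q (Suc n) - nabla q n)"
proof (induction n arbitrary: q)
  case 0
  show ?case by (simp add: nabla_Suc nabla_0 Delta_def)
next
  case (Suc n)
  have "nabla (\<lambda>k. of_nat k * q k) (Suc (Suc n)) =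
        nabla (\<lambda>k. of_nat k * q k) (Suc n) - nabla (\<lambda>k. of_nat (Suc k) * q (Suc k)) (Suc n)"
    by (subst nabla_shift[of "\<lambda>k. of_nat k * q k"]) simp
  also have "(\<lambda>k. of_nat (Suc k) * q (Suc k)) = (\<lambda>k. of_nat k * q (Suc k) + q (Suc k))"
    by (simp add: algebra_simps)
  also have "nabla \<dots> (Suc n) = of_nat (Suc n) * (nabla (\<lambda>k. q (Suc k)) (Suc n)
                - nabla (\<lambda>k. q (Suc k)) n) + nabla (\<lambda>k. q (Suc k)) (Suc n)"
    by (simp only: nabla_add Suc.IH)
  also have "nabla (\<lambda>k. of_nat k * q k) (Suc n) - \<dots> =
               of_nat (Suc (Suc n)) * (nabla q (Suc (Suc n)) - nabla q (Suc n))"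
    by (simp only: Suc.IH nabla_shift) (simp add: algebra_simps)
  finally show ?case .
qed

lemma nabla_div_index:
  "nabla (\<lambda>k. a k / of_nat (Suc k)) n = (\<Sum>k\<le>n. nabla a k) / of_nat (Suc n)"
proof -
  define q where "q = (\<lambda>k. a k / of_nat (Suc k))"
  have a: "a = (\<lambda>k. of_nat k * q k + q k)"
  proof
    fix k
    have "a k = of_nat (Suc k) * q k" by (simp add: q_def del: of_nat_Suc)
    then show "a k = of_nat k * q k + q k" by (simp add: algebra_simps)
  qed
  have "(\<Sum>k\<le>n. nabla a k) = of_nat (Suc n) * nabla q n"
  proof (induction n)
    case 0
    show ?case by (simp add: a nabla_0)
  next
    case (Suc n)
    have "nabla a (Suc n) = of_nat (Suc n) * (nabla q (Suc n) - nabla q n) + nabla q (Suc n)"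
      unfolding a by (simp only: nabla_add nabla_times_index)
    then show ?case by (simp add: Suc.IH algebra_simps)
  qed
  then show ?thesis by (simp add: q_def del: of_nat_Suc)
qed

section \<open>Duality of multi-indices\<close>

text \<open>Every multi-index arises from \<open>(1)\<close> by raising the first entry and by putting a new entry 1 in
  front. All recursions below follow these two steps.\<close>

lemma multi_index_induct [consumes 1, case_names one Suc one_Cons]:
  assumes "multi_index \<beta>"
    and "P [1]"
    and "\<And>a \<beta>. a > 0 \<Longrightarrow> multi_index (a # \<beta>) \<Longrightarrow> P (a # \<beta>) \<Longrightarrow> P (Suc a # \<beta>)"
    and "\<And>\<beta>. multi_index \<beta> \<Longrightarrow> P \<beta> \<Longrightarrow> P (1 # \<beta>)"
  shows "P \<beta>"
  using assms(1)
proof (induction \<beta>)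
  case Nil
  then show ?case by (simp add: multi_index_def)
next
  case (Cons b \<beta>)
  have pos: "multi_index (Suc a # \<beta>)" for a
    using Cons.prems by (auto simp: multi_index_def)
  have "P (Suc a # \<beta>)" for a
  proof (induction a)
    case 0
    show ?case
    proof (cases "\<beta> = []")
      case False
      then have "multi_index \<beta>" using Cons.prems by (auto simp: multi_index_def)
      then show ?thesis using assms(4) Cons.IH by simp
    qed (use assms(2) in simp)
  next
    case (Suc a)
    then show ?case using assms(3) pos by simp
  qed
  moreover have "b > 0" using Cons.prems by (simp add: multi_index_def)
  ultimately show ?case by (metis gr0_implies_Suc)
qed

lemma multi_index_hd_ge: "multi_index \<beta> \<Longrightarrow> hd \<beta> \<ge> 1"
  by (cases \<beta>) (auto simp: multi_index_def)

lemma partial_sums_Cons: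
  assumes "\<beta> \<noteq> []"
  shows "partial_sums (a # \<beta>) = insert a ((+) a ` partial_sums \<beta>)"
proof (intro equalityI subsetI)
  fix x assume "x \<in> partial_sums (a # \<beta>)"
  then obtain k where k: "x = sum_list (take k (a # \<beta>))" "1 \<le> k" "k < Suc (length \<beta>)"
    by (auto simp: partial_sums_def)
  then obtain j where j: "k = Suc j" by (cases k) auto
  show "x \<in> insert a ((+) a ` partial_sums \<beta>)"
    using k j by (cases j) (force simp: partial_sums_def)+
next
  fix x assume "x \<in> insert a ((+) a ` partial_sums \<beta>)"
  then consider "x = a" | k where "x = a + sum_list (take k \<beta>)" "1 \<le> k" "k < length \<beta>"
    by (auto simp: partial_sums_def)
  then show "x \<in> partial_sums (a # \<beta>)"
  proof cases
    case 1
    then show ?thesis using assms unfolding partial_sums_def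
      by (auto intro!: exI[of _ 1] simp: Suc_le_eq)
  next
    case 2
    then show ?thesis unfolding partial_sums_def
      by (auto intro!: exI[of _ "Suc k"])
  qed
qed

lemma partial_sums_Suc: "partial_sums (Suc a # \<beta>) = Suc ` partial_sums (a # \<beta>)"
  by (cases "\<beta> = []") (auto simp: partial_sums_singleton partial_sums_Cons image_image)

lemma dual_eqI:
  assumes "multi_index \<alpha>" "multi_index \<gamma>" "weight \<gamma> = weight \<alpha>"
    and "partial_sums \<gamma> = {1..<weight \<alpha>} - partial_sums \<alpha>"
  shows "dual \<alpha> = \<gamma>"
  using assms by (intro partial_sums_inj) (simp_all add: dual_props)

lemma dual_one: "dual [1] = [1]"
  by (rule dual_eqI) (auto simp: multi_index_def partial_sums_singleton)

lemma weight_pos: "multi_index \<beta> \<Longrightarrow> weight \<beta> \<ge> 1"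
  by (cases \<beta>) (auto simp: multi_index_def)

lemma atLeastLessThan_1_Suc: "w \<ge> 1 \<Longrightarrow> {1..<Suc w} = insert 1 (Suc ` {1..<w})"
  by auto

text \<open>In terms of subsets, raising the first entry shifts the set by 1, and a new first entry 1
  also inserts the element 1. Complementation exchanges the two, which is the content of this fact and
  the next.\<close>

lemma dual_Suc:
  assumes "multi_index (a # \<beta>)"
  shows "dual (Suc a # \<beta>) = 1 # dual (a # \<beta>)"
proof (rule dual_eqI)
  note d = dual_props[OF assms]
  show "multi_index (Suc a # \<beta>)" "multi_index (1 # dual (a # \<beta>))"
    using assms d(1) by (auto simp: multi_index_def)
  show "weight (1 # dual (a # \<beta>)) = weight (Suc a # \<beta>)"
    using d(2) by simp
  have "dual (a # \<beta>) \<noteq> []" using d(1) by (simp add: multi_index_def)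
  then have "partial_sums (1 # dual (a # \<beta>)) =
      insert 1 (Suc ` {1..<weight (a # \<beta>)} - Suc ` partial_sums (a # \<beta>))"
    by (simp only: partial_sums_Cons[OF \<open>dual (a # \<beta>) \<noteq> []\<close>] d(3)
          image_set_diff[OF inj_Suc, symmetric] plus_1_eq_Suc)
  also have "\<dots> = {1..<Suc (weight (a # \<beta>))} - Suc ` partial_sums (a # \<beta>)"
    using partial_sums_subset[OF assms]
    unfolding atLeastLessThan_1_Suc[OF weight_pos[OF assms]] by force
  finally show "partial_sums (1 # dual (a # \<beta>)) =
      {1..<weight (Suc a # \<beta>)} - partial_sums (Suc a # \<beta>)"
    by (simp add: partial_sums_Suc)
qed

lemma dual_one_Cons:
  assumes "multi_index \<beta>"
  shows "dual (1 # \<beta>) = Suc (hd (dual \<beta>)) # tl (dual \<beta>)"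
proof (rule dual_eqI)
  note d = dual_props[OF assms]
  have ne: "dual \<beta> \<noteq> []" "\<beta> \<noteq> []" using d(1) assms by (simp_all add: multi_index_def)
  then obtain h t where ht: "dual \<beta> = h # t" by (cases "dual \<beta>") auto
  show "multi_index (1 # \<beta>)" "multi_index (Suc (hd (dual \<beta>)) # tl (dual \<beta>))"
    using assms d(1) ht by (auto simp: multi_index_def)
  show "weight (Suc (hd (dual \<beta>)) # tl (dual \<beta>)) = weight (1 # \<beta>)"
    using d(2) ht by simp
  have "partial_sums (Suc (hd (dual \<beta>)) # tl (dual \<beta>)) =
      Suc ` {1..<weight \<beta>} - Suc ` partial_sums \<beta>"
    using d(3) by (simp only: partial_sums_Suc ht list.sel image_set_diff[OF inj_Suc, symmetric])
  also have "\<dots> = {1..<Suc (weight \<beta>)} - insert 1 (Suc ` partial_sums \<beta>)"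
    unfolding atLeastLessThan_1_Suc[OF weight_pos[OF assms]] by force
  finally show "partial_sums (Suc (hd (dual \<beta>)) # tl (dual \<beta>)) =
      {1..<weight (1 # \<beta>)} - partial_sums (1 # \<beta>)"
    using ne by (simp add: partial_sums_Cons)
qed

text \<open>Both steps of the induction are \<open>nabla_div_index\<close>: directly when the first entry is raised, and for
  the inverse operation, with \<open>\<nabla>\<close> an involution, when an entry 1 is put in front.\<close>

lemma nabla_lead_sum:
  assumes "multi_index \<alpha>"
  shows "nabla (lead_sum \<alpha>) = lead_sum (dual \<alpha>)"
  using assms
proof (induction \<alpha> rule: multi_index_induct)
  case one
  have "nabla (\<lambda>k. 1) (Suc n) = 0" for n
    using nabla_shift[of "\<lambda>k. 1" n] by simp
  then have c: "nabla (\<lambda>k. 1) n = (if n = 0 then 1 else 0)" for n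
    by (cases n) (simp_all add: nabla_0)
  show ?case
  proof
    fix n
    have "lead_sum [1] = (\<lambda>k. 1 / of_nat (Suc k))"
      by (auto simp: lead_sum_def S_Nil)
    then show "nabla (lead_sum [1]) n = lead_sum (dual [1]) n"
      using nabla_div_index[of "\<lambda>k. 1" n] unfolding dual_one
      by (simp add: c if_distrib sum.If_cases del: of_nat_Suc)
  qed
next
  case (Suc a \<beta>)
  have ne: "dual (a # \<beta>) \<noteq> []" using dual_props(1)[OF Suc(2)] by (simp add: multi_index_def)
  show ?case
  proof
    fix n
    have "nabla (lead_sum (Suc a # \<beta>)) n = (\<Sum>k\<le>n. lead_sum (dual (a # \<beta>)) k) / of_nat (Suc n)"
      using nabla_div_index[of "lead_sum (a # \<beta>)" n] Suc.IH
      by (simp add: lead_sum_Suc[abs_def] del: of_nat_Suc)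
    then show "nabla (lead_sum (Suc a # \<beta>)) n = lead_sum (dual (Suc a # \<beta>)) n"
      unfolding dual_Suc[OF Suc(2)] lead_sum_1 S_eq_sum_lead_sum[OF ne] lessThan_Suc_atMost .
  qed
next
  case (one_Cons \<beta>)
  have ne: "\<beta> \<noteq> []" using one_Cons(1) by (simp add: multi_index_def)
  have ne': "dual \<beta> \<noteq> []" using dual_props(1)[OF one_Cons(1)] by (simp add: multi_index_def)
  have bidual: "nabla (lead_sum (dual \<beta>)) = lead_sum \<beta>"
    using one_Cons.IH nabla_nabla by metis
  have "nabla (\<lambda>k. lead_sum (dual \<beta>) k / of_nat (Suc k)) = lead_sum (1 # \<beta>)"
    using nabla_div_index[of "lead_sum (dual \<beta>)"]
    by (simp add: fun_eq_iff bidual lead_sum_1 S_eq_sum_lead_sum[OF ne] lessThan_Suc_atMost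
             del: of_nat_Suc One_nat_def)
  then have "nabla (lead_sum (1 # \<beta>)) = (\<lambda>k. lead_sum (dual \<beta>) k / of_nat (Suc k))"
    using nabla_nabla by metis
  then show ?case
    using lead_sum_Suc[of "hd (dual \<beta>)" "tl (dual \<beta>)"] ne'
    by (simp add: fun_eq_iff dual_one_Cons[OF one_Cons(1), simplified] del: of_nat_Suc)
qed

lemma nabla_S:
  assumes "multi_index \<alpha>"
  shows "nabla (S \<alpha>) (Suc n) = - lead_sum (dual \<alpha>) n"
proof -
  have "\<alpha> \<noteq> []" using assms by (simp add: multi_index_def)
  then have "Delta (S \<alpha>) = (\<lambda>k. - lead_sum \<alpha> k)"
    by (auto simp: Delta_def S_Suc)
  then show ?thesis
    using nabla_lead_sum[OF assms] by (simp add: nabla_Suc nabla_uminus)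
qed

section \<open>Growth of the harmonic sums\<close>

text \<open>The true growth is at most that of a power of \<open>ln n\<close>; an arbitrarily small power of \<open>n\<close> is enough for the
  convergence arguments.\<close>

lemma S_growth:
  assumes "\<forall>b\<in>set \<beta>. b > 0" "\<epsilon> > 0"
  shows "\<exists>K\<ge>0. \<forall>n. norm (S \<beta> (Suc n)) \<le> K * real (Suc n) powr \<epsilon>"
  using assms
proof (induction \<beta> arbitrary: \<epsilon>)
  case Nil
  then show ?case
    by (intro exI[of _ 1]) (auto simp: S_Nil intro!: ge_one_powr_ge_zero)
next
  case (Cons b \<beta>)
  \<comment> \<open>Half of the exponent is spent on the inner sum, which leaves terms of size \<open>k powr (e - 1)\<close>. Bounding
    \<open>k powr \<epsilon>\<close> by \<open>n powr \<epsilon>\<close> turns them into \<open>k powr (- 1 - e)\<close>, the terms of a convergent series.\<close>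
  define e where "e = \<epsilon> / 2"
  have e: "e > 0" "\<epsilon> = e + e" using Cons.prems by (simp_all add: e_def)
  from Cons.IH[of e] Cons.prems e obtain K where
    K: "K \<ge> 0" "\<And>n. norm (S \<beta> (Suc n)) \<le> K * real (Suc n) powr e" by auto
  have summ: "summable (\<lambda>n. real (Suc n) powr (- 1 - e))"
    using summable_real_powr_iff[of "- 1 - e"] e(1)
    by (subst summable_Suc_iff[of "\<lambda>n. real n powr (- 1 - e)"]) simp
  define Z where "Z = (\<Sum>n. real (Suc n) powr (- 1 - e))"
  have Z: "Z \<ge> 0" unfolding Z_def by (intro suminf_nonneg summ) auto
  have "norm (S (b # \<beta>) (Suc n)) \<le> K * Z * real (Suc n) powr \<epsilon>" for n
  proof -
    have "norm (S \<beta> (Suc k) / of_nat (Suc k) ^ b)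
            \<le> K * real (Suc n) powr \<epsilon> * real (Suc k) powr (- 1 - e)" if "k < Suc n" for k
    proof -
      have "norm (S \<beta> (Suc k) / of_nat (Suc k) ^ b) \<le> K * real (Suc k) powr e / real (Suc k) ^ 1"
        unfolding norm_divide norm_power norm_of_nat
        using K Cons.prems(1) by (intro frac_le power_increasing) auto
      also have "\<dots> = K * (real (Suc k) powr \<epsilon> * real (Suc k) powr (- 1 - e))"
        by (simp add: powr_add[symmetric] e(2)) (simp add: powr_diff)
      also have "\<dots> \<le> K * (real (Suc n) powr \<epsilon> * real (Suc k) powr (- 1 - e))"
        using that Cons.prems(2) K(1) by (intro mult_left_mono mult_right_mono powr_mono2) auto
      finally show ?thesis by (simp add: mult_ac)
    qed
    then have "norm (S (b # \<beta>) (Suc n))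
        \<le> (\<Sum>k<Suc n. K * real (Suc n) powr \<epsilon> * real (Suc k) powr (- 1 - e))"
      unfolding S_Cons by (intro sum_norm_le) auto
    also have "\<dots> = K * real (Suc n) powr \<epsilon> * (\<Sum>k<Suc n. real (Suc k) powr (- 1 - e))"
      by (simp only: sum_distrib_left)
    also have "\<dots> \<le> K * real (Suc n) powr \<epsilon> * Z"
      unfolding Z_def using K(1) by (intro mult_left_mono sum_le_suminf summ) auto
    finally show ?thesis by (simp add: mult_ac)
  qed
  then show ?case using K(1) Z by (intro exI[of _ "K * Z"]) auto
qed

lemma lead_sum_growth:
  assumes "multi_index \<beta>" "\<epsilon> > 0"
  shows "\<exists>K\<ge>0. \<forall>n. norm (lead_sum \<beta> n) \<le> K * real (Suc n) powr (\<epsilon> - real (hd \<beta>))"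
proof -
  from assms have "\<forall>b\<in>set (tl \<beta>). b > 0" by (cases \<beta>) (auto simp: multi_index_def)
  from S_growth[OF this assms(2)] obtain K where
    K: "K \<ge> 0" "\<And>n. norm (S (tl \<beta>) (Suc n)) \<le> K * real (Suc n) powr \<epsilon>" by blast
  have "norm (lead_sum \<beta> n) \<le> K * real (Suc n) powr (\<epsilon> - real (hd \<beta>))" for n
  proof -
    have "norm (lead_sum \<beta> n) \<le> K * real (Suc n) powr \<epsilon> / real (Suc n) ^ hd \<beta>"
      unfolding lead_sum_def norm_divide norm_power norm_of_nat
      by (intro divide_right_mono K) simp
    then show ?thesis by (simp add: powr_diff powr_realpow del: of_nat_Suc)
  qed
  then show ?thesis using K(1) by blast
qed

section \<open>The connector\<close>

text \<open>With \<open>N = n + 1\<close> this is \<open>m! N! / (m + N)!\<close> times \<open>(-1)\<^sup>n (z gchoose N) / z\<close>, a ratio that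
  extends continuously to \<open>z = 0\<close>. The factor in \<open>m\<close> and \<open>N\<close> alone is the connector of the
  connected sums for multiple zeta values.\<close>

definition conn :: "complex \<Rightarrow> nat \<Rightarrow> nat \<Rightarrow> complex" where
  "conn z n m = fact m * pochhammer (1 - z) n / fact (Suc (m + n))"

lemma conn_0: "conn z 0 m = 1 / of_nat (Suc m)"
  by (simp add: conn_def)

lemma conn_Suc_right: "conn z n (Suc m) = of_nat (Suc m) / of_nat (m + n + 2) * conn z n m"
  by (simp add: conn_def algebra_simps)

lemma conn_Suc_left: "conn z (Suc n) m = (of_nat (Suc n) - z) / of_nat (m + n + 2) * conn z n m"
  by (simp add: conn_def pochhammer_Suc algebra_simps)

lemma conn_diff_right:
  "conn z n m - conn z n (Suc m) = of_nat (Suc n) / of_nat (Suc m) * conn z n (Suc m)"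
proof -
  have "complex_of_nat (Suc m) + of_nat (Suc n) \<noteq> 0"
    by (simp only: of_nat_add[symmetric] of_nat_eq_0_iff)
  moreover have "complex_of_nat (m + n + 2) = of_nat (Suc m) + of_nat (Suc n)" by simp
  ultimately show ?thesis
    unfolding conn_Suc_right by (simp add: field_simps del: of_nat_Suc of_nat_add add_2_eq_Suc')
qed

text \<open>Differences in \<open>m\<close> turn into differences in \<open>n\<close>, which is what makes summation by parts possible.\<close>

lemma conn_diff_left:
  "conn z n m - conn z (Suc n) m =
     (of_nat (Suc m) + z) / of_nat (Suc n) * (conn z n m - conn z n (Suc m))"
proof -
  have field: "c - (N - z) / (M + N) * c = (M + z) / N * (N / M * (M / (M + N) * c))"
    if "M + N \<noteq> 0" "M \<noteq> 0" "N \<noteq> 0" for M N c :: complex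
    using that by (simp add: divide_simps) (simp add: algebra_simps)
  have sum: "complex_of_nat (m + n + 2) = of_nat (Suc m) + of_nat (Suc n)" by simp
  show ?thesis
    unfolding conn_diff_right
    unfolding conn_Suc_right conn_Suc_left sum
    by (rule field) (simp_all only: of_nat_add[symmetric] of_nat_eq_0_iff)
qed

text \<open>The bound at \<open>m + j\<close> is uniform in \<open>n\<close> and tends to 0 with growing \<open>j\<close>, hence the
  connected sums tend to 0.\<close>

lemma norm_conn_antimono:
  "norm (conn z n (m + j)) \<le> real (Suc m) / real (Suc (m + j)) * norm (conn z n m)"
proof (induction j)
  case (Suc j)
  have "norm (conn z n (m + Suc j)) =
          real (Suc (m + j)) / real (m + j + n + 2) * norm (conn z n (m + j))"
    by (simp only: add_Suc_right conn_Suc_right norm_mult norm_divide norm_of_nat)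
  also have "\<dots> \<le> real (Suc (m + j)) / real (Suc (m + Suc j)) *
                 (real (Suc m) / real (Suc (m + j)) * norm (conn z n m))"
    by (intro mult_mono frac_le Suc.IH) auto
  finally show ?case by (simp del: of_nat_Suc of_nat_add)
qed simp

text \<open>Up to powers of \<open>n\<close> and \<open>n!\<close>, these are the partial products for the reciprocal Gamma
  function at \<open>1 - z\<close>, which converge at every point.\<close>

lemma pochhammer_growth:
  "\<exists>K\<ge>0. \<forall>n. norm (pochhammer (1 - z) n) \<le> K * fact n * real (Suc n) powr (- Re z)"
proof -
  define r where "r = (\<lambda>n. norm (pochhammer (1 - z) n) / (fact n * real (Suc n) powr (- Re z)))"
  have "Bseq (rGamma_series (1 - z))"
    using rGamma_series_LIMSEQ[of "1 - z"] by (intro convergent_imp_Bseq) (auto simp: convergent_def)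
  then obtain C where C: "C > 0" "\<And>n. norm (rGamma_series (1 - z) n) \<le> C"
    by (auto simp: Bseq_def)
  \<comment> \<open>The factor 3 bounds \<open>(n + 2) / n\<close> and is the cost of replacing powers of \<open>n\<close>, as they occur in
    the product formula, by powers of \<open>n + 2\<close>.\<close>
  have r: "r (Suc n) \<le> C * 3 powr \<bar>Re z\<bar>" if "n > 0" for n
  proof -
    have "norm (rGamma_series (1 - z) n) =
            norm (pochhammer (1 - z) (Suc n)) / (fact n * real n powr (1 - Re z))"
      using that by (simp add: rGamma_series_def norm_divide norm_mult powr_def mult_ac)
    then have "norm (pochhammer (1 - z) (Suc n)) \<le> C * (fact n * real n powr (1 - Re z))"
      using C(2)[of n] that by (simp add: pos_divide_le_eq)
    also have "real n powr (1 - Re z) = real n * real n powr (- Re z)"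
      using that by (simp add: powr_diff powr_minus field_simps)
    also have "C * (fact n * (real n * real n powr (- Re z))) \<le>
               C * (fact (Suc n) * (3 powr \<bar>Re z\<bar> * real (Suc (Suc n)) powr (- Re z)))"
    proof -
      have "real n powr (- Re z) \<le> 3 powr \<bar>Re z\<bar> * real (Suc (Suc n)) powr (- Re z)"
      proof -
        have "real n powr (- Re z) =
            real (Suc (Suc n)) powr (- Re z) * (real (Suc (Suc n)) / real n) powr Re z"
          using that by (simp add: powr_divide powr_minus inverse_eq_divide)
        also have "(real (Suc (Suc n)) / real n) powr Re z \<le> (real (Suc (Suc n)) / real n) powr \<bar>Re z\<bar>"
          using that by (intro powr_mono) auto
        also have "\<dots> \<le> 3 powr \<bar>Re z\<bar>"
          using that by (intro powr_mono2) (auto simp: divide_simps)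
        finally show ?thesis by (simp add: mult_ac mult_left_mono del: of_nat_Suc)
      qed
      then have "real n * real n powr (- Re z) \<le>
          real (Suc n) * (3 powr \<bar>Re z\<bar> * real (Suc (Suc n)) powr (- Re z))"
        by (intro mult_mono) auto
      then show ?thesis using C(1) by (simp add: mult_ac del: of_nat_Suc)
    qed
    finally show ?thesis
      unfolding r_def by (simp add: divide_simps mult_ac del: of_nat_Suc fact_Suc)
  qed
  \<comment> \<open>The product formula covers the arguments from 2 on.\<close>
  define K where "K = C * 3 powr \<bar>Re z\<bar> + r 0 + r 1"
  have r_nonneg: "r n \<ge> 0" for n by (simp add: r_def)
  have "r n \<le> K" for n
  proof -
    consider "n = 0" | "n = 1" | k where "n = Suc k" "k > 0"
      by (metis One_nat_def gr0_conv_Suc not0_implies_Suc)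
    then show ?thesis
    proof cases
      case 3
      then show ?thesis using r[OF 3(2)] r_nonneg[of 0] r_nonneg[of 1] by (simp add: K_def)
    qed (use C(1) r_nonneg[of 0] r_nonneg[of 1] in \<open>simp_all add: K_def\<close>)
  qed
  then have "norm (pochhammer (1 - z) n) \<le> K * fact n * real (Suc n) powr (- Re z)" for n
    using spec[of "\<lambda>n. r n \<le> K" n] by (simp add: r_def pos_divide_le_eq mult_ac del: of_nat_Suc)
  moreover have "K \<ge> 0" using C(1) r_nonneg by (simp add: K_def)
  ultimately show ?thesis by blast
qed

lemma conn_growth:
  "\<exists>K\<ge>0. \<forall>n. norm (conn z n m) \<le> K * real (Suc n) powr (- (Re z + real m + 1))"
proof -
  obtain K where K: "K \<ge> 0"
    "\<And>n. norm (pochhammer (1 - z) n) \<le> K * fact n * real (Suc n) powr (- Re z)"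
    using pochhammer_growth[of z] by blast
  have "norm (conn z n m) \<le> (fact m * K) * real (Suc n) powr (- (Re z + real m + 1))" for n
  proof -
    have "fact n * Suc n ^ Suc m \<le> fact (Suc (m + n))"
    proof (induction m)
      case (Suc m)
      have "fact n * Suc n ^ Suc (Suc m) = (fact n * Suc n ^ Suc m) * Suc n"
        by (simp only: power_Suc mult_ac)
      also have "\<dots> \<le> fact (Suc (m + n)) * Suc (Suc (m + n))"
        by (intro mult_mono Suc.IH) auto
      also have "\<dots> = fact (Suc (Suc m + n))" by simp
      finally show ?case .
    qed simp
    then have le: "fact n * real (Suc n) ^ Suc m \<le> fact (Suc (m + n))"
      by (metis of_nat_fact of_nat_le_iff of_nat_mult of_nat_power)
    have "norm (conn z n m) = fact m * norm (pochhammer (1 - z) n) / fact (Suc (m + n))"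
      by (simp add: conn_def norm_mult norm_divide del: fact_Suc)
    also have "\<dots> \<le> fact m * (K * fact n * real (Suc n) powr (- Re z)) / (fact n * real (Suc n) ^ Suc m)"
      by (intro frac_le mult_left_mono K le) (auto simp: K(1))
    also have "\<dots> = fact m * K * (real (Suc n) powr (- Re z) / real (Suc n) powr real (Suc m))"
      by (subst powr_realpow) (auto simp del: of_nat_Suc)
    also have "real (Suc n) powr (- Re z) / real (Suc n) powr real (Suc m) =
                real (Suc n) powr (- (Re z + real m + 1))"
      unfolding powr_diff[symmetric] by (rule arg_cong[where f = "(powr) _"]) simp
    finally show ?thesis .
  qed
  then show ?thesis using K(1) by (intro exI[of _ "fact m * K"]) auto
qed

definition conn_sum :: "complex \<Rightarrow> nat list \<Rightarrow> nat \<Rightarrow> complex" where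
  "conn_sum z \<beta> m = (\<Sum>n. conn z n m * lead_sum \<beta> n)"

lemma summable_norm_conn_sum:
  assumes "multi_index \<beta>" "Re z + real m + real (hd \<beta>) > 0"
  shows "summable (\<lambda>n. norm (conn z n m * lead_sum \<beta> n))"
proof -
  define \<epsilon> where "\<epsilon> = (Re z + real m + real (hd \<beta>)) / 2"
  have "\<epsilon> > 0" using assms by (simp add: \<epsilon>_def)
  obtain K where K: "K \<ge> 0"
    "\<And>n. norm (lead_sum \<beta> n) \<le> K * real (Suc n) powr (\<epsilon> - real (hd \<beta>))"
    using lead_sum_growth[OF assms(1) \<open>\<epsilon> > 0\<close>] by blast
  obtain L where L: "L \<ge> 0"
    "\<And>n. norm (conn z n m) \<le> L * real (Suc n) powr (- (Re z + real m + 1))"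
    using conn_growth[of z m] by blast
  have "summable (\<lambda>n. L * K * real (Suc n) powr (- 1 - \<epsilon>))"
    using summable_real_powr_iff[of "- 1 - \<epsilon>"] \<open>\<epsilon> > 0\<close>
    by (intro summable_mult, subst summable_Suc_iff[of "\<lambda>n. real n powr (- 1 - \<epsilon>)"]) simp
  then show ?thesis
  proof (rule summable_comparison_test')
    fix n
    have "norm (conn z n m * lead_sum \<beta> n) \<le>
      (L * real (Suc n) powr (- (Re z + real m + 1))) * (K * real (Suc n) powr (\<epsilon> - real (hd \<beta>)))"
      unfolding norm_mult by (intro mult_mono K L mult_nonneg_nonneg) auto
    also have "\<dots> = L * K * (real (Suc n) powr (- (Re z + real m + 1)) * real (Suc n) powr (\<epsilon> - real (hd \<beta>)))"
      by (simp only: mult_ac)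
    also have "real (Suc n) powr (- (Re z + real m + 1)) * real (Suc n) powr (\<epsilon> - real (hd \<beta>))
                 = real (Suc n) powr (- 1 - \<epsilon>)"
      unfolding powr_add[symmetric] by (rule arg_cong[where f = "(powr) _"]) (simp add: \<epsilon>_def field_simps)
    finally show "norm (norm (conn z n m * lead_sum \<beta> n)) \<le> L * K * real (Suc n) powr (- 1 - \<epsilon>)"
      by simp
  qed
qed

lemma conn_sum_sums:
  assumes "multi_index \<beta>" "Re z + real m + real (hd \<beta>) > 0"
  shows "(\<lambda>n. conn z n m * lead_sum \<beta> n) sums conn_sum z \<beta> m"
  unfolding conn_sum_def
  by (rule summable_sums[OF summable_norm_cancel[OF summable_norm_conn_sum[OF assms]]])

lemma conn_sum_tendsto_0:
  assumes "multi_index \<beta>" "Re z + real m + real (hd \<beta>) > 0"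
  shows "(\<lambda>j. conn_sum z \<beta> (m + j)) \<longlonglongrightarrow> 0"
proof (rule Lim_null_comparison)
  define K where "K = (\<Sum>n. norm (conn z n m * lead_sum \<beta> n))"
  note summ = summable_norm_conn_sum[OF assms]
  have "norm (conn_sum z \<beta> (m + j)) \<le> real (Suc m) / real (Suc (m + j)) * K" for j
  proof -
    have "norm (conn_sum z \<beta> (m + j)) \<le>
        (\<Sum>n. real (Suc m) / real (Suc (m + j)) * norm (conn z n m * lead_sum \<beta> n))"
      unfolding conn_sum_def
    proof (rule norm_suminf_le)
      fix n
      have "norm (conn z n (m + j)) * norm (lead_sum \<beta> n) \<le>
          real (Suc m) / real (Suc (m + j)) * norm (conn z n m) * norm (lead_sum \<beta> n)"
        by (intro mult_right_mono norm_conn_antimono norm_ge_zero)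
      then show "norm (conn z n (m + j) * lead_sum \<beta> n) \<le>
              real (Suc m) / real (Suc (m + j)) * norm (conn z n m * lead_sum \<beta> n)"
        by (simp only: norm_mult mult.assoc)
    qed (intro summable_mult summ)
    then show ?thesis
      using suminf_mult[OF summ] by (simp only: K_def)
  qed
  then show "\<forall>\<^sub>F j in sequentially. norm (conn_sum z \<beta> (m + j)) \<le> real (Suc m) / real (Suc (m + j)) * K"
    by simp
  show "(\<lambda>j. real (Suc m) / real (Suc (m + j)) * K) \<longlonglongrightarrow> 0"
    using tendsto_mult_right_zero[OF LIMSEQ_ignore_initial_segment[OF LIMSEQ_inverse_real_of_nat],
        of "real (Suc m) * K" m]
    by (simp only: divide_inverse mult_ac add.commute[of m])
qed

text \<open>The boundary term of the summation by parts in \<open>conn_sum_one_Cons\<close>.\<close>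

lemma conn_times_S_tendsto_0:
  assumes "\<forall>b\<in>set \<beta>. b > 0" "Re z + real m + 1 > 0"
  shows "(\<lambda>n. conn z n m * S \<beta> n) \<longlonglongrightarrow> 0"
proof -
  define \<epsilon> where "\<epsilon> = (Re z + real m + 1) / 2"
  have e: "\<epsilon> > 0" using assms by (simp add: \<epsilon>_def)
  obtain K where K: "K \<ge> 0" "\<And>n. norm (S \<beta> (Suc n)) \<le> K * real (Suc n) powr \<epsilon>"
    using S_growth[OF assms(1) e] by blast
  obtain L where L: "L \<ge> 0"
    "\<And>n. norm (conn z n m) \<le> L * real (Suc n) powr (- (Re z + real m + 1))"
    using conn_growth[of z m] by blast
  have "(\<lambda>n. conn z (Suc n) m * S \<beta> (Suc n)) \<longlonglongrightarrow> 0"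
  proof (rule Lim_null_comparison)
    show "(\<lambda>n. L * K * real (Suc n) powr (- \<epsilon>)) \<longlonglongrightarrow> 0"
      using e by (intro tendsto_mult_right_zero tendsto_neg_powr filterlim_compose[OF
          filterlim_real_sequentially filterlim_Suc]) auto
    have "norm (conn z (Suc n) m * S \<beta> (Suc n)) \<le> L * K * real (Suc n) powr (- \<epsilon>)" for n
    proof -
      have "real (Suc (Suc n)) powr (- (Re z + real m + 1)) \<le> real (Suc n) powr (- (Re z + real m + 1))"
        using assms(2) by (intro powr_mono2') auto
      then have "norm (conn z (Suc n) m) \<le> L * real (Suc n) powr (- (Re z + real m + 1))"
        using L(2)[of "Suc n"] L(1) by (meson mult_left_mono order_trans)
      then have "norm (conn z (Suc n) m * S \<beta> (Suc n)) \<le>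
        (L * real (Suc n) powr (- (Re z + real m + 1))) * (K * real (Suc n) powr \<epsilon>)"
        unfolding norm_mult by (intro mult_mono K L mult_nonneg_nonneg) auto
      also have "\<dots> = L * K * (real (Suc n) powr (- (Re z + real m + 1)) * real (Suc n) powr \<epsilon>)"
        by (simp only: mult_ac)
      also have "real (Suc n) powr (- (Re z + real m + 1)) * real (Suc n) powr \<epsilon> = real (Suc n) powr (- \<epsilon>)"
        unfolding powr_add[symmetric] by (rule arg_cong[where f = "(powr) _"]) (simp add: \<epsilon>_def field_simps)
      finally show ?thesis .
    qed
    then show "\<forall>\<^sub>F n in sequentially.
        norm (conn z (Suc n) m * S \<beta> (Suc n)) \<le> L * K * real (Suc n) powr (- \<epsilon>)" by simp
  qed
  then show ?thesis by (rule LIMSEQ_imp_Suc)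
qed

section \<open>Transport relations\<close>

lemma conn_sum_telescope:
  assumes "multi_index \<beta>" "Re z + real m + real (hd \<beta>) > 0"
  shows "(\<lambda>j. conn_sum z \<beta> (m + j) - conn_sum z \<beta> (Suc (m + j))) sums conn_sum z \<beta> m"
  using telescope_sums'[OF conn_sum_tendsto_0[OF assms]] by simp

text \<open>Termwise: the difference of connectors contains the factor \<open>n + 1\<close>, which cancels one power of the
  denominator of \<open>lead_sum\<close>.\<close>

lemma conn_sum_Suc:
  assumes "multi_index (a # \<beta>)" "Re z + real m + real (Suc a) > 0"
  shows "conn_sum z (Suc a # \<beta>) m - conn_sum z (Suc a # \<beta>) (Suc m) =
           conn_sum z (a # \<beta>) (Suc m) / of_nat (Suc m)"
proof -
  have mi: "multi_index (Suc a # \<beta>)" using assms(1) by (simp add: multi_index_def)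
  have "conn z n m * lead_sum (Suc a # \<beta>) n - conn z n (Suc m) * lead_sum (Suc a # \<beta>) n =
        conn z n (Suc m) * lead_sum (a # \<beta>) n / of_nat (Suc m)" for n
    unfolding left_diff_distrib[symmetric] conn_diff_right lead_sum_Suc
    by (simp add: field_simps del: of_nat_Suc)
  moreover have "(\<lambda>n. conn z n m * lead_sum (Suc a # \<beta>) n - conn z n (Suc m) * lead_sum (Suc a # \<beta>) n)
     sums (conn_sum z (Suc a # \<beta>) m - conn_sum z (Suc a # \<beta>) (Suc m))"
    using assms by (intro sums_diff conn_sum_sums mi) simp_all
  ultimately have "(\<lambda>n. conn z n (Suc m) * lead_sum (a # \<beta>) n / of_nat (Suc m))
     sums (conn_sum z (Suc a # \<beta>) m - conn_sum z (Suc a # \<beta>) (Suc m))"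
    by simp
  moreover have "(\<lambda>n. conn z n (Suc m) * lead_sum (a # \<beta>) n / of_nat (Suc m))
      sums (conn_sum z (a # \<beta>) (Suc m) / of_nat (Suc m))"
    using assms by (intro sums_divide conn_sum_sums) simp_all
  ultimately show ?thesis by (rule sums_unique2)
qed

text \<open>The factor \<open>n + 1\<close> now cancels the whole denominator of \<open>lead_sum\<close>, and a difference in \<open>n\<close>
  against the partial sums \<open>S\<close> remains.\<close>

lemma conn_sum_one_Cons_aux:
  assumes "\<forall>b\<in>set \<beta>. b > 0" "Re z + real m + 1 > 0"
    and "(\<lambda>n. (conn z n m - conn z (Suc n) m) * S \<beta> (Suc n)) sums T"
  shows "conn_sum z (1 # \<beta>) m - conn_sum z (1 # \<beta>) (Suc m) = T / (of_nat (Suc m) + z)"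
proof -
  have mi: "multi_index (1 # \<beta>)" using assms(1) by (simp add: multi_index_def)
  have "Re (of_nat (Suc m) + z) > 0" using assms(2) by simp
  then have nz: "of_nat (Suc m) + z \<noteq> 0" by (metis less_irrefl zero_complex.sel(1))
  have "conn z n m * lead_sum (1 # \<beta>) n - conn z n (Suc m) * lead_sum (1 # \<beta>) n =
        (conn z n m - conn z (Suc n) m) * S \<beta> (Suc n) / (of_nat (Suc m) + z)" for n
    unfolding left_diff_distrib[symmetric] conn_diff_left lead_sum_1
    using nz by (simp del: of_nat_Suc)
  moreover have "(\<lambda>n. conn z n m * lead_sum (1 # \<beta>) n - conn z n (Suc m) * lead_sum (1 # \<beta>) n)
     sums (conn_sum z (1 # \<beta>) m - conn_sum z (1 # \<beta>) (Suc m))"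
    using assms by (intro sums_diff conn_sum_sums mi) simp_all
  ultimately have "(\<lambda>n. (conn z n m - conn z (Suc n) m) * S \<beta> (Suc n) / (of_nat (Suc m) + z))
     sums (conn_sum z (1 # \<beta>) m - conn_sum z (1 # \<beta>) (Suc m))"
    by (simp only:)
  then show ?thesis
    using sums_divide[OF assms(3)] by (rule sums_unique2)
qed

text \<open>For the empty tail the partial sums are constantly 1 and the series telescopes to its first
  connector.\<close>

lemma conn_sum_one:
  assumes "Re z + real m + 1 > 0"
  shows "conn_sum z [1] m - conn_sum z [1] (Suc m) = 1 / (of_nat (Suc m) * (of_nat (Suc m) + z))"
proof -
  have "(\<lambda>n. conn z n m - conn z (Suc n) m) sums (conn z 0 m - 0)"
    using conn_times_S_tendsto_0[of "[]" z m] assms by (intro telescope_sums') (simp add: S_Nil)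
  then have "(\<lambda>n. (conn z n m - conn z (Suc n) m) * S [] (Suc n)) sums (1 / of_nat (Suc m))"
    by (simp add: S_Nil conn_0)
  from conn_sum_one_Cons_aux[OF _ assms this] show ?thesis by simp
qed

text \<open>Summation by parts turns the partial sums of \<open>\<beta>\<close> back into its terms.\<close>

lemma conn_sum_one_Cons:
  assumes "multi_index \<beta>" "Re z + real m + 1 > 0"
  shows "conn_sum z (1 # \<beta>) m - conn_sum z (1 # \<beta>) (Suc m) =
           conn_sum z \<beta> m / (of_nat (Suc m) + z)"
proof (rule conn_sum_one_Cons_aux)
  have ne: "\<beta> \<noteq> []" using assms(1) by (simp add: multi_index_def)
  show pos: "\<forall>b\<in>set \<beta>. b > 0" using assms(1) by (simp add: multi_index_def)
  show "Re z + real m + 1 > 0" by fact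
  have "hd \<beta> \<ge> 1" using assms(1) by (rule multi_index_hd_ge)
  then have "(\<lambda>n. conn z n m * lead_sum \<beta> n) sums conn_sum z \<beta> m"
    using assms by (intro conn_sum_sums) auto
  moreover have "(\<lambda>n. conn z n m * S \<beta> n - conn z (Suc n) m * S \<beta> (Suc n)) sums (0 - 0)"
    using telescope_sums'[OF conn_times_S_tendsto_0[OF pos assms(2)]] by (simp add: S_0 ne)
  ultimately have "(\<lambda>n. conn z n m * lead_sum \<beta> n +
      (conn z n m * S \<beta> n - conn z (Suc n) m * S \<beta> (Suc n))) sums (conn_sum z \<beta> m + (0 - 0))"
    by (rule sums_add)
  then show "(\<lambda>n. (conn z n m - conn z (Suc n) m) * S \<beta> (Suc n)) sums conn_sum z \<beta> m"
    by (simp add: S_Suc[OF ne] algebra_simps)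
qed

section \<open>The families indexing the sum for G\<close>

lemma G_indices_Nil: "G_indices [] = {[]}"
  by (auto simp: G_indices_def)

lemma G_indices_snoc:
  "ms @ [r] \<in> G_indices (\<alpha> @ [a]) \<longleftrightarrow>
     ms \<in> G_indices \<alpha> \<and> length r = a \<and> sorted_wrt (>) r \<and> (\<forall>k\<in>set r. k > 0) \<and>
     (\<alpha> \<noteq> [] \<longrightarrow> last (last ms) \<ge> hd r)"
  (is "?L \<longleftrightarrow> ?R")
proof (cases "length ms = length \<alpha>")
  case True
  let ?row = "\<lambda>m b. length m = b \<and> sorted_wrt (>) m \<and> (\<forall>k\<in>set m. k > (0::nat))"
  have "(\<forall>i<Suc (length \<alpha>). ?row ((ms @ [r]) ! i) ((\<alpha> @ [a]) ! i)) \<longleftrightarrow>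
        (\<forall>i<length \<alpha>. ?row (ms ! i) (\<alpha> ! i)) \<and> ?row r a"
    unfolding All_less_Suc using True by (simp add: nth_append conj_commute)
  moreover have "(\<forall>i. Suc i < Suc (length \<alpha>) \<longrightarrow> last ((ms @ [r]) ! i) \<ge> hd ((ms @ [r]) ! Suc i)) \<longleftrightarrow>
        (\<forall>i. Suc i < length \<alpha> \<longrightarrow> last (ms ! i) \<ge> hd (ms ! Suc i)) \<and>
        (\<alpha> \<noteq> [] \<longrightarrow> last (last ms) \<ge> hd r)"
  proof (cases "\<alpha> = []")
    case False
    then obtain l where l: "length \<alpha> = Suc l" by (cases \<alpha>) auto
    have "last ms = ms ! l" using True l by (metis diff_Suc_1 last_conv_nth length_0_conv nat.distinct(1))
    then show ?thesis
      using True l False by (auto simp: nth_append less_Suc_eq)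
  qed simp
  ultimately show ?thesis
    unfolding G_indices_def using True by auto
qed (simp add: G_indices_def)

lemma G_indices_snoc_cases:
  assumes "ms \<in> G_indices (\<alpha> @ [a])"
  obtains ms' r where "ms = ms' @ [r]"
  using assms by (cases ms rule: rev_cases) (auto simp: G_indices_def)

text \<open>The families for the reversal of \<open>\<beta>\<close> whose smallest entry, the last one of the last row, exceeds
  \<open>m\<close>. Reversal makes the first entry of \<open>\<beta>\<close> the length of the last row, so that the recursion on the
  front of \<open>\<beta>\<close> adds smallest entries.\<close>

definition G_above :: "nat list \<Rightarrow> nat \<Rightarrow> nat list list set" where
  "G_above \<beta> m = {ms \<in> G_indices (rev \<beta>). last (last ms) > m}"

definition append_entry :: "nat \<times> nat list list \<Rightarrow> nat list list" where
  "append_entry = (\<lambda>(k, ms). butlast ms @ [last ms @ [k]])"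

definition append_row :: "nat \<times> nat list list \<Rightarrow> nat list list" where
  "append_row = (\<lambda>(k, ms). ms @ [[k]])"

lemma G_above_one: "G_above [1] m = (\<lambda>j. [[Suc (m + j)]]) ` UNIV"
proof (intro equalityI subsetI)
  fix ms assume ms: "ms \<in> G_above [1] m"
  then have "ms \<in> G_indices ([] @ [1])" by (simp add: G_above_def)
  then obtain ms' r where "ms = ms' @ [r]" by (rule G_indices_snoc_cases)
  with ms have "ms' @ [r] \<in> G_indices ([] @ [1])" "last r > m"
    by (simp_all add: G_above_def)
  then obtain k where "ms = [[k]]" "k > m"
    unfolding G_indices_snoc using \<open>ms = ms' @ [r]\<close> by (auto simp: G_indices_Nil length_Suc_conv)
  then show "ms \<in> (\<lambda>j. [[Suc (m + j)]]) ` UNIV"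
    by (auto dest!: less_imp_Suc_add)
next
  fix ms assume "ms \<in> (\<lambda>j. [[Suc (m + j)]]) ` (UNIV :: nat set)"
  then obtain j where "ms = [] @ [[Suc (m + j)]]" by auto
  then show "ms \<in> G_above [1] m"
    using G_indices_snoc[of "[]" "[Suc (m + j)]" "[]" 1] by (simp add: G_above_def G_indices_Nil)
qed

text \<open>The removed entry \<open>m + j + 1\<close> lies strictly below the rest of its row.\<close>

lemma G_above_Suc:
  assumes "a > 0"
  shows "G_above (Suc a # \<beta>) m =
    append_entry ` (\<lambda>(j, ms). (Suc (m + j), ms)) ` (SIGMA j:UNIV. G_above (a # \<beta>) (Suc (m + j)))"
proof (intro equalityI subsetI)
  fix ms assume ms: "ms \<in> G_above (Suc a # \<beta>) m"
  then have "ms \<in> G_indices (rev \<beta> @ [Suc a])" by (simp add: G_above_def)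
  then obtain ms' r where ms': "ms = ms' @ [r]" by (rule G_indices_snoc_cases)
  with ms have *: "ms' @ [r] \<in> G_indices (rev \<beta> @ [Suc a])" "last r > m"
    by (simp_all add: G_above_def)
  then have "length r = Suc a" by (simp add: G_indices_snoc)
  then obtain r' k where r: "r = r' @ [k]" by (cases r rule: rev_cases) auto
  have r': "r' \<noteq> []" using \<open>length r = Suc a\<close> assms r by auto
  have "last r' > k" using *(1) r r' by (simp add: G_indices_snoc sorted_wrt_append)
  moreover have "ms' @ [r'] \<in> G_indices (rev \<beta> @ [a])"
    using *(1) r r' by (simp add: G_indices_snoc sorted_wrt_append)
  ultimately have "ms' @ [r'] \<in> G_above (a # \<beta>) k" by (simp add: G_above_def)
  moreover obtain j where "k = Suc (m + j)"
    using *(2) r by (auto dest!: less_imp_Suc_add)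
  moreover have "ms = append_entry (k, ms' @ [r'])" by (simp add: append_entry_def ms' r)
  ultimately show "ms \<in> append_entry ` (\<lambda>(j, ms). (Suc (m + j), ms)) `
      (SIGMA j:UNIV. G_above (a # \<beta>) (Suc (m + j)))"
    by (auto intro!: image_eqI)
next
  fix ms assume "ms \<in> append_entry ` (\<lambda>(j, ms). (Suc (m + j), ms)) `
      (SIGMA j:UNIV. G_above (a # \<beta>) (Suc (m + j)))"
  then obtain j ns where ns: "ms = append_entry (Suc (m + j), ns)" "ns \<in> G_above (a # \<beta>) (Suc (m + j))"
    by auto
  then have "ns \<in> G_indices (rev \<beta> @ [a])" by (simp add: G_above_def)
  then obtain ns' r where ns': "ns = ns' @ [r]" by (rule G_indices_snoc_cases)
  then have *: "ns' @ [r] \<in> G_indices (rev \<beta> @ [a])" "last r > Suc (m + j)"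
    using ns(2) by (simp_all add: G_above_def)
  then have r: "r \<noteq> []" using assms by (auto simp: G_indices_snoc)
  have ge: "x \<ge> last r" if "x \<in> set r" for x
    using *(1) r that by (cases r rule: rev_cases) (auto simp: G_indices_snoc sorted_wrt_append)
  have "ns' @ [r @ [Suc (m + j)]] \<in> G_indices (rev \<beta> @ [Suc a])"
    using * r ge by (fastforce simp: G_indices_snoc sorted_wrt_append)
  then show "ms \<in> G_above (Suc a # \<beta>) m"
    by (simp add: ns(1) ns' append_entry_def G_above_def)
qed

text \<open>The removed entry \<open>m + j + 1\<close> starts a row of its own, hence the entries before it may be equal to
  it: they only have to exceed \<open>m + j\<close>.\<close>

lemma G_above_one_Cons:
  assumes "\<beta> \<noteq> []"
  shows "G_above (1 # \<beta>) m =
    append_row ` (\<lambda>(j, ms). (Suc (m + j), ms)) ` (SIGMA j:UNIV. G_above \<beta> (m + j))"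
proof (intro equalityI subsetI)
  fix ms assume ms: "ms \<in> G_above (1 # \<beta>) m"
  then have "ms \<in> G_indices (rev \<beta> @ [1])" by (simp add: G_above_def)
  then obtain ms' r where ms': "ms = ms' @ [r]" by (rule G_indices_snoc_cases)
  with ms have *: "ms' @ [r] \<in> G_indices (rev \<beta> @ [1])" "last r > m"
    by (simp_all add: G_above_def)
  then obtain k where r: "r = [k]" by (auto simp: G_indices_snoc length_Suc_conv)
  obtain j where j: "k = Suc (m + j)"
    using *(2) r by (auto dest!: less_imp_Suc_add)
  have "ms' \<in> G_above \<beta> (m + j)"
    using *(1) assms r j by (auto simp: G_indices_snoc G_above_def)
  moreover have "ms = append_row (k, ms')" by (simp add: append_row_def ms' r)
  ultimately show "ms \<in> append_row ` (\<lambda>(j, ms). (Suc (m + j), ms)) `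
      (SIGMA j:UNIV. G_above \<beta> (m + j))"
    using j by (auto intro!: image_eqI)
next
  fix ms assume "ms \<in> append_row ` (\<lambda>(j, ms). (Suc (m + j), ms)) ` (SIGMA j:UNIV. G_above \<beta> (m + j))"
  then obtain j ns where "ms = ns @ [[Suc (m + j)]]" "ns \<in> G_above \<beta> (m + j)"
    by (auto simp: append_row_def)
  then show "ms \<in> G_above (1 # \<beta>) m"
    by (auto simp: G_above_def G_indices_snoc)
qed

lemma G_above_not_Nil: "\<beta> \<noteq> [] \<Longrightarrow> ms \<in> G_above \<beta> m \<Longrightarrow> ms \<noteq> []"
  by (auto simp: G_above_def G_indices_def)

lemma G_above_last_not_Nil:
  assumes "a > 0" "ms \<in> G_above (a # \<beta>) m"
  shows "last ms \<noteq> []"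
proof -
  have "ms \<in> G_indices (rev \<beta> @ [a])" using assms by (simp add: G_above_def)
  moreover then obtain ms' r where "ms = ms' @ [r]" by (rule G_indices_snoc_cases)
  ultimately show ?thesis using assms(1) by (auto simp: G_indices_snoc)
qed

section \<open>The normalised summand\<close>

definition row_factor :: "'a::field_char_0 \<Rightarrow> nat list \<Rightarrow> 'a" where
  "row_factor z r = 1 / (of_nat (hd r) + z) * (\<Prod>k\<leftarrow>tl r. 1 / of_nat k)"

text \<open>The summand of \<open>G\<close> divided by \<open>z\<close>, which leaves \<open>1 / (k (k + z))\<close> for the first entry \<open>k\<close>. The
  division makes the summand positive at real points on both sides of 0; the polymorphic type gives it
  as a real number there.\<close>

definition G_weight :: "'a::field_char_0 \<Rightarrow> nat list list \<Rightarrow> 'a" where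
  "G_weight z ms = (\<Prod>r\<leftarrow>ms. row_factor z r) / of_nat (hd (hd ms))"

lemma G_weight_one: "G_weight z [[k]] = 1 / (of_nat k * (of_nat k + z))"
  by (simp add: G_weight_def row_factor_def)

lemma G_weight_append_entry:
  assumes "ms \<noteq> []" "last ms \<noteq> []"
  shows "G_weight z (append_entry (k, ms)) = 1 / of_nat k * G_weight z ms"
proof -
  from assms obtain ns h t where ms: "ms = ns @ [h # t]"
    by (cases ms rule: rev_cases) (auto simp: neq_Nil_conv)
  have "hd (hd (ns @ [h # t @ [k]])) = hd (hd (ns @ [h # t]))"
    by (cases ns) auto
  then show ?thesis
    by (simp add: ms append_entry_def G_weight_def row_factor_def)
qed

lemma G_weight_append_row:
  "ms \<noteq> [] \<Longrightarrow> G_weight z (append_row (k, ms)) = 1 / (of_nat k + z) * G_weight z ms"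
  by (simp add: append_row_def G_weight_def row_factor_def)

text \<open>Follows the construction of families from the largest entry to the smallest.\<close>

lemma G_above_induct [consumes 2, case_names one entry row]:
  assumes "multi_index \<beta>" "ms \<in> G_above \<beta> m"
    and one: "\<And>m j. P [1] m [[Suc (m + j)]]"
    and entry: "\<And>a \<beta> m j ms. \<lbrakk>multi_index (a # \<beta>); ms \<in> G_above (a # \<beta>) (Suc (m + j)); ms \<noteq> []; last ms \<noteq> [];
        P (a # \<beta>) (Suc (m + j)) ms\<rbrakk> \<Longrightarrow> P (Suc a # \<beta>) m (append_entry (Suc (m + j), ms))"
    and row: "\<And>\<beta> m j ms. \<lbrakk>multi_index \<beta>; ms \<in> G_above \<beta> (m + j); ms \<noteq> [];
        P \<beta> (m + j) ms\<rbrakk> \<Longrightarrow> P (1 # \<beta>) m (append_row (Suc (m + j), ms))"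
  shows "P \<beta> m ms"
  using assms(1,2)
proof (induction \<beta> arbitrary: m ms rule: multi_index_induct)
  case one
  then show ?case using assms(3) unfolding G_above_one by auto
next
  case (Suc a \<beta>)
  from Suc.prems obtain j ns where "ms = append_entry (Suc (m + j), ns)" "ns \<in> G_above (a # \<beta>) (Suc (m + j))"
    unfolding G_above_Suc[OF Suc(1)] by auto
  then show ?case
    using entry[OF Suc(2)] Suc.IH G_above_not_Nil G_above_last_not_Nil[OF Suc(1)] by (metis list.distinct(1))
next
  case (one_Cons \<beta>)
  then have ne: "\<beta> \<noteq> []" by (simp add: multi_index_def)
  from one_Cons.prems obtain j ns where "ms = append_row (Suc (m + j), ns)" "ns \<in> G_above \<beta> (m + j)"
    unfolding G_above_one_Cons[OF ne] by auto
  then show ?case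
    using row[OF one_Cons(1)] one_Cons.IH G_above_not_Nil[OF ne] by metis
qed

text \<open>In the half-plane considered, this keeps \<open>m\<^sub>1\<^sub>,\<^sub>1 + z\<close> away from 0, which is where
  dividing the first factor of the summand by \<open>z\<close> could fail.\<close>

lemma hd_hd_ge:
  assumes "multi_index \<beta>" "ms \<in> G_above \<beta> m"
  shows "hd (hd ms) \<ge> m + hd \<beta>"
  using assms
proof (induction rule: G_above_induct)
  case (entry a \<beta> m j ms)
  have "hd (hd (append_entry (Suc (m + j), ms))) = hd (hd ms)"
    using entry(3,4) by (cases ms) (auto simp: append_entry_def)
  then show ?case using entry by simp
next
  case (row \<beta> m j ms)
  have "hd \<beta> \<ge> 1" using row(1) by (rule multi_index_hd_ge)
  then show ?case using row by (simp add: append_row_def)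
qed simp

text \<open>Each factor \<open>1 / (k + z)\<close> is dominated by its value at \<open>Re z\<close>, since \<open>k + Re z > 0\<close> for every
  entry \<open>k\<close> that starts a row. This provides the summable majorant.\<close>

lemma norm_G_weight_le:
  assumes "multi_index \<beta>" "ms \<in> G_above \<beta> m" "Re z + real m + real (hd \<beta>) > 0"
  shows "norm (G_weight z ms) \<le> G_weight (Re z) ms"
proof -
  have le: "norm (1 / (of_nat k + z)) \<le> 1 / (real k + Re z)" if "real k + Re z > 0" for k
    using that complex_Re_le_cmod[of "of_nat k + z"] unfolding norm_divide norm_one
    by (intro divide_left_mono mult_pos_pos) auto
  show ?thesis using assms
  proof (induction rule: G_above_induct)
    case (one m j)
    have "norm (1 / (of_nat (Suc (m + j)) + z)) / real (Suc (m + j)) \<le>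
          1 / (real (Suc (m + j)) + Re z) / real (Suc (m + j))"
      using one by (intro divide_right_mono le) auto
    then show ?case by (simp add: G_weight_one norm_divide norm_mult mult_ac del: of_nat_Suc)
  next
    case (entry a \<beta> m j ms)
    then have "norm (G_weight z ms) \<le> G_weight (Re z) ms" by simp
    then show ?case
      using entry(3,4) by (simp add: G_weight_append_entry norm_divide divide_right_mono del: of_nat_Suc)
  next
    case (row \<beta> m j ms)
    have "hd \<beta> \<ge> 1" using row(1) by (rule multi_index_hd_ge)
    then have "norm (G_weight z ms) \<le> G_weight (Re z) ms" using row by simp
    then show ?case
      unfolding G_weight_append_row[OF row(3)] norm_mult
      using row.prems by (intro mult_mono le) (auto intro: add_nonneg_nonneg)
  qed
qed

section \<open>Summation\<close>

lemma has_sum_Sigma_nonneg: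
  fixes f :: "nat \<Rightarrow> 'b \<Rightarrow> real"
  assumes "\<And>j. (f j has_sum h j) (B j)" "h sums c" "\<And>j y. y \<in> B j \<Longrightarrow> f j y \<ge> 0"
  shows "((\<lambda>(j, y). f j y) has_sum c) (SIGMA j:UNIV. B j)"
proof -
  have "h j \<ge> 0" for j using assms(1,3) by (rule has_sum_nonneg)
  then have h: "(h has_sum c) UNIV" using assms(2) by (intro sums_nonneg_imp_has_sum) auto
  moreover have "(\<lambda>(j, y). f j y) summable_on (SIGMA j:UNIV. B j)"
    using h assms by (intro summable_on_SigmaI[where g = h]) (auto simp: summable_on_def)
  ultimately show ?thesis using assms(1) by (intro has_sum_SigmaI[where g = h]) auto
qed

lemma has_sum_Sigma_summable:
  fixes f :: "nat \<Rightarrow> 'b \<Rightarrow> complex"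
  assumes "\<And>j. (f j has_sum h j) (B j)" "h sums c"
    and "(\<lambda>(j, y). f j y) summable_on (SIGMA j:UNIV. B j)"
  shows "((\<lambda>(j, y). f j y) has_sum c) (SIGMA j:UNIV. B j)"
proof -
  obtain T where T: "((\<lambda>(j, y). f j y) has_sum T) (SIGMA j:UNIV. B j)"
    using assms(3) by (auto simp: summable_on_def)
  then have "(h has_sum T) UNIV" using assms(1) by (intro has_sum_SigmaD[OF T]) auto
  then have "T = c" using assms(2) has_sum_imp_sums sums_unique2 by blast
  then show ?thesis using T by simp
qed

text \<open>The recursions for the index sets, rewritten as iterated sums. They hold in any normed field, which
  serves both the complex sum and its real majorant.\<close>

lemma has_sum_G_above_one:
  fixes z :: "'a::{real_normed_field}"
  shows "(G_weight z has_sum c) (G_above [1] m) \<longleftrightarrow>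
    ((\<lambda>j. 1 / (of_nat (Suc (m + j)) * (of_nat (Suc (m + j)) + z))) has_sum c) UNIV"
  unfolding G_above_one
  by (subst has_sum_reindex) (auto simp: inj_on_def o_def G_weight_one)

lemma has_sum_G_above_Suc:
  fixes z :: "'a::{real_normed_field}"
  assumes "a > 0"
  shows "(G_weight z has_sum c) (G_above (Suc a # \<beta>) m) \<longleftrightarrow>
    ((\<lambda>(j, ms). 1 / of_nat (Suc (m + j)) * G_weight z ms) has_sum c)
      (SIGMA j:UNIV. G_above (a # \<beta>) (Suc (m + j)))"
proof -
  let ?A = "SIGMA j:UNIV. G_above (a # \<beta>) (Suc (m + j))"
  let ?h = "\<lambda>(j, ms). append_entry (Suc (m + j), ms)"
  have ne: "ms \<noteq> []" "last ms \<noteq> []" if "(j, ms) \<in> ?A" for j ms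
    using that G_above_not_Nil[of "a # \<beta>"] G_above_last_not_Nil[OF assms] by auto
  have inj: "inj_on ?h ?A"
    using ne by (auto simp: inj_on_def append_entry_def) (metis append_butlast_last_id)+
  have "G_above (Suc a # \<beta>) m = ?h ` ?A"
    unfolding G_above_Suc[OF assms] image_image by (simp add: case_prod_unfold)
  then show ?thesis
    using has_sum_reindex[OF inj, of "G_weight z" c]
    by (simp only:) (intro has_sum_cong, use ne in \<open>auto simp: G_weight_append_entry\<close>)
qed

lemma has_sum_G_above_one_Cons:
  fixes z :: "'a::{real_normed_field}"
  assumes "\<beta> \<noteq> []"
  shows "(G_weight z has_sum c) (G_above (1 # \<beta>) m) \<longleftrightarrow>
    ((\<lambda>(j, ms). 1 / (of_nat (Suc (m + j)) + z) * G_weight z ms) has_sum c)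
      (SIGMA j:UNIV. G_above \<beta> (m + j))"
proof -
  let ?A = "SIGMA j:UNIV. G_above \<beta> (m + j)"
  let ?h = "\<lambda>(j, ms). append_row (Suc (m + j), ms)"
  have ne: "ms \<noteq> []" if "(j, ms) \<in> ?A" for j ms
    using that G_above_not_Nil[OF assms] by auto
  have inj: "inj_on ?h ?A"
    by (auto simp: inj_on_def append_row_def)
  have "G_above (1 # \<beta>) m = ?h ` ?A"
    unfolding G_above_one_Cons[OF assms] image_image by (simp add: case_prod_unfold)
  then show ?thesis
    using has_sum_reindex[OF inj, of "G_weight z" c]
    by (simp only:) (intro has_sum_cong, use ne in \<open>auto simp: G_weight_append_row\<close>)
qed

text \<open>The transport relations telescoped from \<open>m\<close> to infinity.\<close>

lemma conn_sum_one_sums: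
  assumes "Re z + real m + 1 > 0"
  shows "(\<lambda>j. 1 / (of_nat (Suc (m + j)) * (of_nat (Suc (m + j)) + z))) sums conn_sum z [1] m"
proof -
  have "conn_sum z [1] (m + j) - conn_sum z [1] (Suc (m + j)) =
      1 / (of_nat (Suc (m + j)) * (of_nat (Suc (m + j)) + z))" for j
    using assms by (intro conn_sum_one) simp
  then show ?thesis
    using conn_sum_telescope[of "[1]" z m] assms by (simp add: multi_index_def del: of_nat_Suc)
qed

lemma conn_sum_Suc_sums:
  assumes "multi_index (a # \<beta>)" "Re z + real m + real (Suc a) > 0"
  shows "(\<lambda>j. 1 / of_nat (Suc (m + j)) * conn_sum z (a # \<beta>) (Suc (m + j))) sums
           conn_sum z (Suc a # \<beta>) m"
proof -
  have "conn_sum z (Suc a # \<beta>) (m + j) - conn_sum z (Suc a # \<beta>) (Suc (m + j)) =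
      1 / of_nat (Suc (m + j)) * conn_sum z (a # \<beta>) (Suc (m + j))" for j
    using assms by (subst conn_sum_Suc) simp_all
  moreover have "multi_index (Suc a # \<beta>)" using assms(1) by (simp add: multi_index_def)
  ultimately show ?thesis
    using conn_sum_telescope[of "Suc a # \<beta>" z m] assms(2) by (simp del: of_nat_Suc)
qed

lemma conn_sum_one_Cons_sums:
  assumes "multi_index \<beta>" "Re z + real m + 1 > 0"
  shows "(\<lambda>j. 1 / (of_nat (Suc (m + j)) + z) * conn_sum z \<beta> (m + j)) sums conn_sum z (1 # \<beta>) m"
proof -
  have "conn_sum z (1 # \<beta>) (m + j) - conn_sum z (1 # \<beta>) (Suc (m + j)) =
      1 / (of_nat (Suc (m + j)) + z) * conn_sum z \<beta> (m + j)" for j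
    using assms by (subst conn_sum_one_Cons) simp_all
  moreover have "multi_index (1 # \<beta>)" using assms(1) by (simp add: multi_index_def)
  ultimately show ?thesis
    using conn_sum_telescope[of "1 # \<beta>" z m] assms(2) by (simp del: of_nat_Suc)
qed

lemma G_weight_nonneg:
  assumes "multi_index \<beta>" "ms \<in> G_above \<beta> m" "x + real m + real (hd \<beta>) > 0"
  shows "G_weight x ms \<ge> 0"
  using norm_G_weight_le[OF assms(1,2), of "of_real x"] assms(3)
  by (simp add: order_trans[OF norm_ge_zero])

lemma Re_of_real_mult: "Re (of_real r * w) = r * Re w"
  by simp

text \<open>At real points all terms are nonnegative, so that the iterated sums supplied by the transport
  relations can be combined into one unconditional sum.\<close>

lemma G_weight_has_sum_real:
  assumes "multi_index \<beta>" "x + real m + real (hd \<beta>) > 0"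
  shows "(G_weight x has_sum Re (conn_sum (of_real x) \<beta> m)) (G_above \<beta> m)"
  using assms
proof (induction \<beta> arbitrary: m rule: multi_index_induct)
  case one
  have "(\<lambda>j. Re (1 / (of_nat (Suc (m + j)) * (of_nat (Suc (m + j)) + of_real x)))) sums
          Re (conn_sum (of_real x) [1] m)"
    using one by (intro sums_Re conn_sum_one_sums) simp
  also have "(\<lambda>j. Re (1 / (of_nat (Suc (m + j)) * (of_nat (Suc (m + j)) + of_real x)))) =
      (\<lambda>j. 1 / (of_nat (Suc (m + j)) * (of_nat (Suc (m + j)) + x)))"
  proof
    fix j
    have "1 / (of_nat (Suc (m + j)) * (of_nat (Suc (m + j)) + complex_of_real x)) =
        of_real (1 / (of_nat (Suc (m + j)) * (of_nat (Suc (m + j)) + x)))"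
      by simp
    then show "Re (1 / (of_nat (Suc (m + j)) * (of_nat (Suc (m + j)) + of_real x))) =
        1 / (of_nat (Suc (m + j)) * (of_nat (Suc (m + j)) + x))"
      by (simp only: Re_complex_of_real)
  qed
  finally show ?case
    unfolding has_sum_G_above_one using one by (intro sums_nonneg_imp_has_sum) auto
next
  case (Suc a \<beta>)
  have "(\<lambda>j. Re (1 / of_nat (Suc (m + j)) * conn_sum (of_real x) (a # \<beta>) (Suc (m + j)))) sums
          Re (conn_sum (of_real x) (Suc a # \<beta>) m)"
    using Suc by (intro sums_Re conn_sum_Suc_sums) simp_all
  also have "(\<lambda>j. Re (1 / of_nat (Suc (m + j)) * conn_sum (of_real x) (a # \<beta>) (Suc (m + j)))) =
      (\<lambda>j. 1 / of_nat (Suc (m + j)) * Re (conn_sum (of_real x) (a # \<beta>) (Suc (m + j))))"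
  proof
    fix j
    have "1 / complex_of_nat (Suc (m + j)) = of_real (1 / of_nat (Suc (m + j)))"
      by simp
    then show "Re (1 / of_nat (Suc (m + j)) * conn_sum (of_real x) (a # \<beta>) (Suc (m + j))) =
        1 / of_nat (Suc (m + j)) * Re (conn_sum (of_real x) (a # \<beta>) (Suc (m + j)))"
      by (simp only: Re_of_real_mult)
  qed
  finally show ?case
    unfolding has_sum_G_above_Suc[OF Suc(1)]
  proof (rule has_sum_Sigma_nonneg[rotated])
    fix j ms assume "ms \<in> G_above (a # \<beta>) (Suc (m + j))"
    then have "G_weight x ms \<ge> 0"
      using G_weight_nonneg[OF Suc(2), of ms "Suc (m + j)" x] Suc.prems by simp
    then show "1 / real (Suc (m + j)) * G_weight x ms \<ge> 0" by simp
  next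
    fix j
    show "((\<lambda>ms. 1 / real (Suc (m + j)) * G_weight x ms) has_sum
        1 / real (Suc (m + j)) * Re (conn_sum (of_real x) (a # \<beta>) (Suc (m + j))))
        (G_above (a # \<beta>) (Suc (m + j)))"
      using Suc.prems by (intro has_sum_cmult_right Suc.IH) simp
  qed
next
  case (one_Cons \<beta>)
  have ne: "\<beta> \<noteq> []" using one_Cons(1) by (simp add: multi_index_def)
  have hd: "hd \<beta> \<ge> 1" by (rule multi_index_hd_ge) fact
  have "(\<lambda>j. Re (1 / (of_nat (Suc (m + j)) + of_real x) * conn_sum (of_real x) \<beta> (m + j))) sums
          Re (conn_sum (of_real x) (1 # \<beta>) m)"
    using one_Cons by (intro sums_Re conn_sum_one_Cons_sums) simp_all
  also have "(\<lambda>j. Re (1 / (of_nat (Suc (m + j)) + of_real x) * conn_sum (of_real x) \<beta> (m + j))) =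
      (\<lambda>j. 1 / (of_nat (Suc (m + j)) + x) * Re (conn_sum (of_real x) \<beta> (m + j)))"
  proof
    fix j
    have "1 / (complex_of_nat (Suc (m + j)) + of_real x) = of_real (1 / (of_nat (Suc (m + j)) + x))"
      by simp
    then show "Re (1 / (of_nat (Suc (m + j)) + of_real x) * conn_sum (of_real x) \<beta> (m + j)) =
        1 / (of_nat (Suc (m + j)) + x) * Re (conn_sum (of_real x) \<beta> (m + j))"
      by (simp only: Re_of_real_mult)
  qed
  finally show ?case
    unfolding has_sum_G_above_one_Cons[OF ne]
  proof (rule has_sum_Sigma_nonneg[rotated])
    fix j ms assume "ms \<in> G_above \<beta> (m + j)"
    then have "G_weight x ms \<ge> 0"
      using G_weight_nonneg[OF one_Cons(1), of ms "m + j" x] one_Cons.prems hd by simp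
    then show "1 / (real (Suc (m + j)) + x) * G_weight x ms \<ge> 0"
      using one_Cons.prems by simp
  next
    fix j
    show "((\<lambda>ms. 1 / (real (Suc (m + j)) + x) * G_weight x ms) has_sum
        1 / (real (Suc (m + j)) + x) * Re (conn_sum (of_real x) \<beta> (m + j))) (G_above \<beta> (m + j))"
      using one_Cons.prems hd by (intro has_sum_cmult_right one_Cons.IH) simp
  qed
qed

lemma G_weight_summable:
  assumes "multi_index \<beta>" "Re z + real m + real (hd \<beta>) > 0"
  shows "G_weight z summable_on G_above \<beta> m"
proof (rule abs_summable_summable[OF Infinite_Sum.abs_summable_on_comparison_test'])
  show "G_weight (Re z) summable_on G_above \<beta> m"
    using G_weight_has_sum_real[of \<beta> "Re z" m] assms by (auto simp: summable_on_def)
qed (use norm_G_weight_le assms in auto)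

text \<open>Summability is known from the real majorant, and the value of the sum may therefore be computed
  iteratively.\<close>

lemma G_weight_has_sum:
  assumes "multi_index \<beta>" "Re z + real m + real (hd \<beta>) > 0"
  shows "(G_weight z has_sum conn_sum z \<beta> m) (G_above \<beta> m)"
  using assms
proof (induction \<beta> arbitrary: m rule: multi_index_induct)
  case one
  obtain T where T: "(G_weight z has_sum T) (G_above [1] m)"
    using G_weight_summable[of "[1]" z m] one by (auto simp: multi_index_def summable_on_def)
  then have "T = conn_sum z [1] m"
    using conn_sum_one_sums[of z m] one has_sum_imp_sums sums_unique2
    unfolding has_sum_G_above_one by fastforce
  then show ?case using T by simp
next
  case (Suc a \<beta>)
  have "multi_index (Suc a # \<beta>)" using Suc(2) by (simp add: multi_index_def)
  then have "G_weight z summable_on G_above (Suc a # \<beta>) m"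
    using Suc.prems by (intro G_weight_summable) auto
  then show ?case
    unfolding summable_on_def has_sum_G_above_Suc[OF Suc(1)]
  proof (intro has_sum_Sigma_summable[OF _ conn_sum_Suc_sums])
    fix j
    show "((\<lambda>ms. 1 / of_nat (Suc (m + j)) * G_weight z ms) has_sum
        1 / of_nat (Suc (m + j)) * conn_sum z (a # \<beta>) (Suc (m + j)))
        (G_above (a # \<beta>) (Suc (m + j)))"
      using Suc.prems by (intro has_sum_cmult_right Suc.IH) simp
  qed (use Suc in \<open>auto simp: summable_on_def\<close>)
next
  case (one_Cons \<beta>)
  have ne: "\<beta> \<noteq> []" using one_Cons(1) by (simp add: multi_index_def)
  have hd: "hd \<beta> \<ge> 1" by (rule multi_index_hd_ge) fact
  have "multi_index (1 # \<beta>)" using one_Cons(1) by (simp add: multi_index_def)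
  then have "G_weight z summable_on G_above (1 # \<beta>) m"
    using one_Cons.prems by (intro G_weight_summable) auto
  then show ?case
    unfolding summable_on_def has_sum_G_above_one_Cons[OF ne]
  proof (intro has_sum_Sigma_summable[OF _ conn_sum_one_Cons_sums])
    fix j
    show "((\<lambda>ms. 1 / (of_nat (Suc (m + j)) + z) * G_weight z ms) has_sum
        1 / (of_nat (Suc (m + j)) + z) * conn_sum z \<beta> (m + j)) (G_above \<beta> (m + j))"
      using one_Cons.prems hd by (intro has_sum_cmult_right one_Cons.IH) simp
  qed (use one_Cons in \<open>auto simp: summable_on_def\<close>)
qed

section \<open>The Newton series and the function G\<close>

text \<open>Absorption moves a factor \<open>z\<close> out of the binomial coefficient and leaves the connector at 0.\<close>

lemma F_term_Suc:
  assumes "multi_index \<alpha>"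
  shows "F_term \<alpha> z (Suc n) = z * (conn z n 0 * lead_sum (dual \<alpha>) n)"
proof -
  have "z gchoose (Suc n) = z / of_nat (Suc n) * (z - 1 gchoose n)"
    using gbinomial_absorption'[of "Suc n" z] by simp
  also have "\<dots> = (-1) ^ n * (z * conn z n 0)"
    by (simp add: gbinomial_pochhammer[of "z - 1"] conn_def)
  finally show ?thesis
    by (simp add: F_term_def nabla_S[OF assms])
qed

lemma G_term_eq_G_weight:
  assumes "multi_index \<alpha>" "ms \<in> G_indices \<alpha>" "of_nat (hd (hd ms)) + z \<noteq> 0"
  shows "G_term \<alpha> z ms = z * G_weight z ms"
proof -
  have \<alpha>: "\<alpha> \<noteq> []" "\<forall>a\<in>set \<alpha>. a > 0" using assms(1) by (auto simp: multi_index_def)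
  have len: "length ms = length \<alpha>" and row: "\<And>i. i < length \<alpha> \<Longrightarrow> length (ms ! i) = \<alpha> ! i"
    and pos: "\<And>i k. i < length \<alpha> \<Longrightarrow> k \<in> set (ms ! i) \<Longrightarrow> k > 0"
    using assms(2) by (auto simp: G_indices_def)
  have prod_tl: "(\<Prod>j = 1..<\<alpha> ! i. 1 / of_nat (ms ! i ! j)) = (\<Prod>k\<leftarrow>tl (ms ! i). 1 / of_nat k :: complex)"
    if "i < length \<alpha>" for i
  proof -
    have "(\<Prod>k\<leftarrow>tl (ms ! i). 1 / of_nat k :: complex) = (\<Prod>j = 0..<\<alpha> ! i - 1. 1 / of_nat (ms ! i ! Suc j))"
      unfolding prod.list_conv_set_nth using row[OF that] by (simp add: nth_tl)
    also have "\<dots> = (\<Prod>j = 1..<\<alpha> ! i. 1 / of_nat (ms ! i ! j))"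
      using \<alpha>(2) that by (subst prod.atLeast_Suc_lessThan_Suc_shift[symmetric, of _ 0, unfolded o_def])
        (auto simp: Suc_diff_1)
    finally show ?thesis by simp
  qed
  have hd_nth: "hd (ms ! i) = ms ! i ! 0" "ms ! i \<noteq> []" if "i < length \<alpha>" for i
    using row[OF that] \<alpha>(2) that by (metis hd_conv_nth length_0_conv less_irrefl nth_mem)+
  have factor: "row_factor z (ms ! i) = 1 / (of_nat (ms ! i ! 0) + z) * (\<Prod>j = 1..<\<alpha> ! i. 1 / of_nat (ms ! i ! j))"
    if "i < length \<alpha>" for i
    using prod_tl[OF that] hd_nth[OF that] by (simp add: row_factor_def)
  let ?h = "of_nat (ms ! 0 ! 0) :: complex"
  have "ms \<noteq> []" using len \<alpha>(1) by auto
  then have hd_hd: "hd (hd ms) = ms ! 0 ! 0" using hd_nth \<alpha>(1) by (simp add: hd_conv_nth)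
  have "ms ! 0 ! 0 > 0" using pos[of 0] hd_nth(2)[of 0] \<alpha>(1) by (simp add: nth_mem)
  then have h: "1 / ?h - 1 / (?h + z) = z * (1 / (?h + z)) / ?h"
    using assms(3) unfolding hd_hd by (simp add: field_simps)
  have "(\<Prod>r\<leftarrow>ms. row_factor z r) = (\<Prod>i = 0..<length \<alpha>. row_factor z (ms ! i))"
    by (simp add: prod.list_conv_set_nth len)
  also have "\<dots> = row_factor z (ms ! 0) * (\<Prod>i = 1..<length \<alpha>. row_factor z (ms ! i))"
    using \<alpha>(1) by (simp add: prod.atLeast_Suc_lessThan)
  also have "(\<Prod>i = 1..<length \<alpha>. row_factor z (ms ! i)) = (\<Prod>i = 1..<length \<alpha>.
      1 / (of_nat (ms ! i ! 0) + z) * (\<Prod>j = 1..<\<alpha> ! i. 1 / of_nat (ms ! i ! j)))"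
    by (rule prod.cong) (use factor in auto)
  finally show ?thesis
    unfolding G_term_def G_weight_def h hd_hd using factor[of 0] \<alpha>(1) by simp
qed

theorem theorem4p4:
  fixes \<alpha> :: "nat list" and z :: complex
  assumes "multi_index \<alpha>"
    and "Re z > - real (hd (dual \<alpha>))"
  shows "summable (F_term \<alpha> z) \<and>
         G_term (backprime \<alpha>) z summable_on G_indices (backprime \<alpha>) \<and>
         F \<alpha> z = G (backprime \<alpha>) z"
proof -
  define \<beta> where "\<beta> = dual \<alpha>"
  have \<beta>: "multi_index \<beta>" unfolding \<beta>_def by (rule dual_props(1)[OF assms(1)])
  have conv: "Re z + real 0 + real (hd \<beta>) > 0" using assms(2) by (simp add: \<beta>_def)
  have "\<alpha> \<noteq> []" using assms(1) by (simp add: multi_index_def)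
  then have "F_term \<alpha> z 0 = 0" by (simp add: F_term_def nabla_0 S_0)
  moreover have "(\<lambda>n. F_term \<alpha> z (Suc n)) sums (z * conn_sum z \<beta> 0)"
    unfolding F_term_Suc[OF assms(1)] \<beta>_def[symmetric]
    by (intro sums_mult conn_sum_sums \<beta> conv)
  ultimately have F: "F_term \<alpha> z sums (z * conn_sum z \<beta> 0)"
    by (simp add: sums_Suc_iff)
  have rev: "multi_index (rev \<beta>)" using \<beta> by (simp add: multi_index_def)
  have all: "G_above \<beta> 0 = G_indices (rev \<beta>)"
  proof -
    have "last (last ms) > 0" if ms: "ms \<in> G_indices (rev \<beta>)" for ms
    proof -
      have "length ms = length \<beta>" "length \<beta> > 0" using ms \<beta> by (auto simp: G_indices_def multi_index_def)
      then have "last ms = ms ! (length \<beta> - 1)" "length \<beta> - 1 < length (rev \<beta>)"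
        by (auto simp: last_conv_nth simp flip: length_greater_0_conv)
      moreover from this have "length (last ms) = rev \<beta> ! (length \<beta> - 1)" "\<forall>k\<in>set (last ms). k > 0"
        using ms by (auto simp: G_indices_def)
      moreover have "rev \<beta> ! (length \<beta> - 1) > 0"
        using rev calculation(2) nth_mem unfolding multi_index_def by blast
      ultimately show ?thesis by (metis last_in_set length_0_conv less_irrefl)
    qed
    then show ?thesis by (auto simp: G_above_def)
  qed
  have "((\<lambda>ms. z * G_weight z ms) has_sum (z * conn_sum z \<beta> 0)) (G_above \<beta> 0)"
    by (intro has_sum_cmult_right G_weight_has_sum \<beta> conv)
  also have "?this \<longleftrightarrow> (G_term (rev \<beta>) z has_sum (z * conn_sum z \<beta> 0)) (G_above \<beta> 0)"
  proof (rule has_sum_cong)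
    fix ms assume ms: "ms \<in> G_above \<beta> 0"
    have "real (hd (hd ms)) \<ge> real (hd \<beta>)" using hd_hd_ge[OF \<beta> ms] by simp
    then have "Re (of_nat (hd (hd ms)) + z) > 0" using conv by simp
    then have "of_nat (hd (hd ms)) + z \<noteq> 0" by (metis less_irrefl zero_complex.sel(1))
    then show "z * G_weight z ms = G_term (rev \<beta>) z ms"
      using G_term_eq_G_weight[OF rev] ms all by simp
  qed
  finally have G: "(G_term (backprime \<alpha>) z has_sum (z * conn_sum z \<beta> 0)) (G_indices (backprime \<alpha>))"
    unfolding all backprime_def \<beta>_def[symmetric] .
  show ?thesis
    using F G by (auto simp: F_def G_def sums_iff summable_on_def dest: infsumI)
qed

end
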